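(* Suppose Assumptions (A1)–(A3) hold. Fix $\kappa_2>1$, let $\kappa_3=\frac14\big(1+(1+8\kappa_2+\frac8{\rho_2(L)})^{1/2}\big)$, $\tilde\kappa_1=\frac{2+9L_f^2}{2\rho_2(L)}$, $\tilde\kappa_4=6(\kappa_2+\frac1{\rho_2(L)})L_f^2+2\big(9(\kappa_2+\frac1{\rho_2(L)})^2L_f^4+3L_f^2\big)^{1/2}$. Let $\beta>\max\{\frac{\tilde\kappa_1}{\kappa_2-1},\kappa_3,\tilde\kappa_4\}$, $\alpha\in(\beta+\tilde\kappa_1,\kappa_2\beta]$, and define $\tilde\epsilon_1=(\alpha-\beta)\rho_2(L)-\frac12(2+9L_f^2)$, $\tilde\epsilon_2=\beta^2\rho(L)+(2\alpha^2+\beta^2)\rho^2(L)+\frac{15}2L_f^2$, $\epsilon_3=\beta-\frac12-\frac\alpha{2\beta^2}-\frac1{2\beta\rho_2(L)}$, $\epsilon_4=2\beta^2+\frac12$, $\tilde\epsilon_5=\frac18-\frac3{2\beta}(\frac1\beta+\frac1{\rho_2(L)}+\frac\alpha\beta)L_f^2$, $\tilde\epsilon_6=\frac3{\beta^2}(1+\frac1{\rho_2(L)}+\frac\alpha\beta)L_f^2+\frac{L_f(1+3L_f)}2$. Let $\eta\in(0,\min\{\tilde\epsilon_1/\tilde\epsilon_2,\epsilon_3/\epsilon_4,\tilde\epsilon_5/\tilde\epsilon_6\})$ and let $\delta_{i,k}>0$ satisfy $\delta_i^a:=\sum_{k=0}^\infty\delta_{i,k}^2<\infty$ for all $i$. Define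 $\tilde\epsilon_7=\eta\min\{\tilde\epsilon_1-\eta\tilde\epsilon_2,\frac18\}$, $\epsilon_8=\frac{\alpha+\beta}{2\beta}+\frac1{2\rho_2(L)}$, $\epsilon_{12}=\Big(\big(\frac1{\beta^2}+\frac1{2\eta\beta}\big)\big(\frac1{\rho_2(L)}+\frac\alpha\beta\big)+\frac1{2\eta\beta^2}+\frac1{\beta^2}+\frac12\Big)\frac{3npL_f^2}4$, $\epsilon_{11}=\big(\frac{15\eta}4+5\eta^2\big)\frac{3npL_f^2}4+\epsilon_{12}$, $\tilde c=\epsilon_8\hat U_0+(\epsilon_{11}+\epsilon_{12})\sum_{i=1}^n\delta_i^a$. Let $\{\boldsymbol x_k\}$ be generated by Algorithm 2. Then for all $T\in\mathbb N_0$, $$\sum_{k=0}^T\big(\|\boldsymbol x_k-\bar{\boldsymbol x}_k\|^2+\|\bar{\boldsymbol g}^0_k\|^2\big)\le\frac{\tilde c}{\tilde\epsilon_7},\qquad f(\bar x_{T+1})-f^*\le\frac{\tilde c}n.$$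
   Context: Setting: $n$ agents on weighted undirected graph $\mathcal G$ with Laplacian $L=(L_{ij})$; $\rho(L)$ largest eigenvalue, $\rho_2(L)$ smallest positive eigenvalue of $L$. $f_i:\mathbb R^p\to\mathbb R$, $f=\frac1n\sum_if_i$, $\mathbb X^*=\arg\min f$, $f^*=\min f$. Assumptions: (A1) $\mathcal G$ connected; (A2) $\mathbb X^*\ne\emptyset$, $f^*>-\infty$; (A3) each $\nabla f_i$ is $L_f$-Lipschitz ($L_f>0$). Deterministic gradient estimator: for differentiable $h:\mathbb R^p\to\mathbb R$ and $\delta>0$, $\hat\nabla h(x,\delta)=\frac1\delta\sum_{l=1}^p(h(x+\delta e_l)-h(x))e_l$, where $e_1,\dots,e_p$ is the standard basis. Algorithm 2 (parameters $\alpha,\beta,\eta>0$, $\delta_{i,k}>0$): $x_{i,0}\in\mathbb R^p$ arbitrary, $\sum_jv_{j,0}=\mathbf 0_p$, and for $k\ge0$: $x_{i,k+1}=x_{i,k}-\eta(\alpha\sum_jL_{ij}x_{j,k}+\beta v_{i,k}+\hat\nabla f_i(x_{i,k},\delta_{i,k}))$, $v_{i,k+1}=v_{i,k}+\eta\beta\sum_jL_{ij}x_{j,k}$. Notation: $\boldsymbol x_k=\mathrm{col}(x_{i,k})$, $\boldsymbol v_k=\mathrm{col}(v_{i,k})$, $\bar x_k=\frac1n\sum_ix_{i,k}$, $\bar{\boldsymbol x}_k=\mathbf 1_n\otimes\bar x_k$, $\boldsymbol K=(I_n-\frac1n\mathbf 1\mathbf 1^\top)\otimes I_p$, $\|z\|_M^2=z^\top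 Mz$, $\bar{\boldsymbol g}^0_k=\mathbf 1_n\otimes\nabla f(\bar x_k)$, $\delta_k=\max_i\delta_{i,k}$, $\boldsymbol h^0_k=\mathrm{col}(\hat\nabla f_1(\bar x_k,\delta_k),\dots,\hat\nabla f_n(\bar x_k,\delta_k))$, $\hat U_k=\|\boldsymbol x_k\|^2_{\boldsymbol K}+\|\boldsymbol v_k+\frac1\beta\boldsymbol h^0_k\|^2_{\boldsymbol K}+n(f(\bar x_k)-f^* )$. *)

theory Defs
  imports "HOL-Analysis.Analysis"
begin

text \<open>Graph Laplacian of a weighted undirected graph with (symmetric, nonnegative)
  weight matrix A: L_ij = - a_ij for i ~= j, L_ii = sum over j ~= i of a_ij.\<close>
definition laplacian :: "real^'n^'n \<Rightarrow> real^'n^'n" where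
  "laplacian A = (\<chi> i j. if i = j then (\<Sum>k\<in>UNIV - {i}. A$i$k) else - A$i$j)"

definition weighted_undirected_graph :: "real^'n^'n \<Rightarrow> bool" where
  "weighted_undirected_graph A \<longleftrightarrow> (\<forall>i j. A$i$j = A$j$i \<and> 0 \<le> A$i$j)"

text \<open>Connectedness: every pair of agents is joined by a path of positive-weight edges.\<close>
definition graph_connected :: "real^'n^'n \<Rightarrow> bool" where
  "graph_connected A \<longleftrightarrow> (\<forall>i j. (i, j) \<in> {(a, b). a \<noteq> b \<and> 0 < A$a$b}\<^sup>*)"

definition eigenvalues :: "real^'n^'n \<Rightarrow> real set" where
  "eigenvalues M = {\<mu>. \<exists>v. v \<noteq> 0 \<and> M *v v = \<mu> *\<^sub>R v}"

text \<open>rho: largest eigenvalue; rho2: smallest positive eigenvalue.\<close>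
definition rho :: "real^'n^'n \<Rightarrow> real" where
  "rho M = Max (eigenvalues M)"

definition rho2 :: "real^'n^'n \<Rightarrow> real" where
  "rho2 M = Min {\<mu>\<in>eigenvalues M. 0 < \<mu>}"

text \<open>Deterministic finite-difference gradient estimator.\<close>
definition grad_est :: "(real^'p \<Rightarrow> real) \<Rightarrow> real^'p \<Rightarrow> real \<Rightarrow> real^'p" where
  "grad_est h x \<delta> = (1 / \<delta>) *\<^sub>R (\<Sum>l\<in>UNIV. (h (x + \<delta> *\<^sub>R axis l 1) - h x) *\<^sub>R axis l 1)"

text \<open>Average of a stacked vector and the squared K-seminorm z^T K z
  with K = (I - 11^T/n) (x) I_p, written out as sum_i |z_i - zbar|^2.\<close>
definition avg :: "('n::finite \<Rightarrow> real^'p) \<Rightarrow> real^'p" where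
  "avg z = (1 / real CARD('n)) *\<^sub>R (\<Sum>i\<in>UNIV. z i)"

definition knorm2 :: "('n::finite \<Rightarrow> real^'p) \<Rightarrow> real" where
  "knorm2 z = (\<Sum>i\<in>UNIV. (norm (z i - avg z))\<^sup>2)"

text \<open>Global objective f = (1/n) sum_i f_i and its gradient (1/n) sum_i grad f_i.\<close>
definition favg :: "('n::finite \<Rightarrow> 'a \<Rightarrow> real) \<Rightarrow> 'a \<Rightarrow> real" where
  "favg fi y = (1 / real CARD('n)) * (\<Sum>i\<in>UNIV. fi i y)"

definition gavg :: "('n::finite \<Rightarrow> 'a \<Rightarrow> real^'p) \<Rightarrow> 'a \<Rightarrow> real^'p" where
  "gavg gi y = (1 / real CARD('n)) *\<^sub>R (\<Sum>i\<in>UNIV. gi i y)"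

end

theory Submission
  imports Defs
begin

text \<open>Stack the agents' states into block vectors, let \<open>X\<close> be the centered primal state and \<open>w\<close> the
  centered \<open>v + h0 / \<beta>\<close>, where \<open>h0\<close> collects the gradient estimates at the average state. With
  \<open>Q\<close> inverting the Laplacian on centered vectors, the function
  \<open>V = |X|\<^sup>2 / 2 + (w \<bullet> Q w + \<alpha> / \<beta> |w|\<^sup>2) / 2 + X \<bullet> w + n (f(xbar) - f*)\<close>
  makes the first-order cross terms between \<open>X\<close> and \<open>w\<close> cancel. What remains is dissipation of \<open>|X|\<^sup>2\<close>,
  \<open>|w|\<^sup>2\<close>, \<open>|avg h|\<^sup>2\<close> and the squared average gradient; Young's inequality absorbs every
  perturbation into it, up to multiples of the squared smoothing radii. Summing over time gives both bounds.\<close>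

text \<open>The dual step moves \<open>w\<close> only through the Laplacian of \<open>X\<close> and
  the drift of \<open>h0\<close>, so it has no damping of its own. The coupling
  \<open>X \<bullet> w\<close> creates the term \<open>- \<eta> * \<beta> * (w \<bullet> w)\<close>;
  its price is that the dissipation \<open>X \<bullet> Lap X\<close> keeps only the factor
  \<open>\<alpha> - \<beta>\<close>. The other weights are then forced. With
  \<open>z = Lap X\<close>, first order leaves \<open>- \<eta> * \<beta> * (X \<bullet> w)\<close>
  from the primal square and \<open>- \<eta> * \<alpha> * (z \<bullet> w)\<close> from the coupling.
  Since \<open>Q z = X\<close>, the term \<open>w \<bullet> Q w / 2\<close> returns the first with
  opposite sign, and \<open>\<alpha> / \<beta> * (w \<bullet> w) / 2\<close> the second. The shift
  by \<open>h0 / \<beta>\<close> measures how far the dual variable is from balancing the local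
  gradients. Taking \<open>h0\<close> at the average makes its drift proportional to
  \<open>\<eta> * norm (avg h)\<close>, up to smoothing errors. Young's inequality puts a weight of
  order 1/\<eta> on the squared drift, so the cost is again of order \<eta> and competes with the
  descent of the objective; with \<alpha>/\<beta> bounded, a large \<beta> makes it small.\<close>

subsection \<open>Gradient estimates\<close>

lemma gradient_lipschitz_upper:
  fixes h :: "'a::real_inner \<Rightarrow> real"
  assumes grad: "\<And>y. GDERIV h y :> g y"
    and lip: "\<And>y z. norm (g y - g z) \<le> B * norm (y - z)"
  shows "h (x + u) \<le> h x + g x \<bullet> u + B / 2 * (norm u)\<^sup>2"
proof -
  \<comment> \<open>Removing the linear and quadratic terms leaves a derivative that contains only a
    difference of gradients, so monotonicity on [0,1] replaces an integral along the
    segment.\<close>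
  define \<phi> where "\<phi> t = h (x + t *\<^sub>R u) - t * (g x \<bullet> u) - B / 2 * t\<^sup>2 * (norm u)\<^sup>2" for t :: real
  have D: "DERIV \<phi> t :> (g (x + t *\<^sub>R u) - g x) \<bullet> u - B * t * (norm u)\<^sup>2" for t
  proof -
    have "(h has_derivative (\<lambda>k. k \<bullet> g (x + t *\<^sub>R u))) (at (x + t *\<^sub>R u))"
      using grad by (simp add: gderiv_def)
    moreover have "((\<lambda>t. x + t *\<^sub>R u) has_derivative (\<lambda>s. s *\<^sub>R u)) (at t)"
      by (auto intro!: derivative_eq_intros)
    ultimately have "((\<lambda>t. h (x + t *\<^sub>R u)) has_derivative (\<lambda>s. (s *\<^sub>R u) \<bullet> g (x + t *\<^sub>R u))) (at t)"
      using has_derivative_compose by blast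
    then have "DERIV (\<lambda>t. h (x + t *\<^sub>R u)) t :> g (x + t *\<^sub>R u) \<bullet> u"
      by (simp add: has_field_derivative_def inner_commute mult_commute_abs)
    then show ?thesis
      unfolding \<phi>_def
      by (auto intro!: derivative_eq_intros simp: algebra_simps)
  qed
  have "\<phi> 1 \<le> \<phi> 0"
  proof (rule DERIV_nonpos_imp_nonincreasing[where f = \<phi>])
    fix t :: real assume t: "0 \<le> t" "t \<le> 1"
    have "(g (x + t *\<^sub>R u) - g x) \<bullet> u \<le> norm (g (x + t *\<^sub>R u) - g x) * norm u"
      by (rule norm_cauchy_schwarz)
    also have "\<dots> \<le> (B * norm (x + t *\<^sub>R u - x)) * norm u"
      by (intro mult_right_mono lip) auto
    also have "\<dots> = B * t * (norm u)\<^sup>2"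
      using t by (simp add: power2_eq_square)
    finally show "\<exists>y. DERIV \<phi> t :> y \<and> y \<le> 0"
      using D[of t] by auto
  qed simp
  then show ?thesis by (simp add: \<phi>_def)
qed

lemma gradient_lipschitz_abs:
  fixes h :: "'a::real_inner \<Rightarrow> real"
  assumes grad: "\<And>y. GDERIV h y :> g y"
    and lip: "\<And>y z. norm (g y - g z) \<le> B * norm (y - z)"
  shows "\<bar>h (x + u) - h x - g x \<bullet> u\<bar> \<le> B / 2 * (norm u)\<^sup>2"
proof -
  \<comment> \<open>The lower half is the upper bound for \<open>- h\<close>, whose gradient has the
    same Lipschitz constant.\<close>
  have "- h (x + u) \<le> - h x + (- g x) \<bullet> u + B / 2 * (norm u)\<^sup>2"
    using grad lip
    by (intro gradient_lipschitz_upper GDERIV_minus) (simp_all add: norm_minus_commute)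
  moreover have "h (x + u) \<le> h x + g x \<bullet> u + B / 2 * (norm u)\<^sup>2"
    using grad lip by (rule gradient_lipschitz_upper)
  ultimately show ?thesis by (intro abs_leI) (simp_all add: inner_minus_left)
qed

text \<open>Each coordinate of the estimator is a forward difference quotient. The quadratic
  remainder \<open>B / 2 * \<delta>\<^sup>2\<close>, divided by \<delta>, bounds its error, and the
  squares of these errors add up over \<open>CARD('p)\<close> coordinates.\<close>

lemma grad_est_error:
  fixes h :: "real^'p \<Rightarrow> real"
  assumes grad: "\<And>y. GDERIV h y :> g y"
    and lip: "\<And>y z. norm (g y - g z) \<le> B * norm (y - z)"
    and \<delta>: "\<delta> > 0"
  shows "(norm (grad_est h x \<delta> - g x))\<^sup>2 \<le> real CARD('p) * B\<^sup>2 * \<delta>\<^sup>2 / 4"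
proof -
  have comp: "grad_est h x \<delta> $ l = (h (x + \<delta> *\<^sub>R axis l 1) - h x) / \<delta>" for l
    by (simp add: grad_est_def axis_def if_distrib cong: if_cong)
  have "\<bar>(grad_est h x \<delta> - g x) $ l\<bar> \<le> B * \<delta> / 2" for l
  proof -
    have "\<bar>h (x + \<delta> *\<^sub>R axis l 1) - h x - g x \<bullet> (\<delta> *\<^sub>R axis l 1)\<bar> \<le> B / 2 * (norm (\<delta> *\<^sub>R axis l (1::real)))\<^sup>2"
      using grad lip by (rule gradient_lipschitz_abs)
    then have "\<bar>h (x + \<delta> *\<^sub>R axis l 1) - h x - \<delta> * g x $ l\<bar> \<le> B / 2 * \<delta>\<^sup>2"
      by (simp add: inner_axis norm_axis_1)
    moreover have "(grad_est h x \<delta> - g x) $ l = (h (x + \<delta> *\<^sub>R axis l 1) - h x - \<delta> * g x $ l) / \<delta>"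
      using \<delta> by (simp add: comp field_simps)
    ultimately have "\<bar>(grad_est h x \<delta> - g x) $ l\<bar> \<le> (B / 2 * \<delta>\<^sup>2) / \<delta>"
      using \<delta> by (simp only: abs_divide abs_of_pos divide_right_mono less_imp_le)
    then show ?thesis using \<delta> by (simp add: power2_eq_square)
  qed
  then have "((grad_est h x \<delta> - g x) $ l)\<^sup>2 \<le> (B * \<delta> / 2)\<^sup>2" for l
    by (rule abs_le_square_iff[THEN iffD1, OF order_trans]) auto
  then have "(\<Sum>l\<in>UNIV. ((grad_est h x \<delta> - g x) $ l)\<^sup>2) \<le> (\<Sum>l\<in>(UNIV::'p set). (B * \<delta> / 2)\<^sup>2)"
    by (rule sum_mono)
  then show ?thesis
    by (simp add: norm_vec_def L2_set_def sum_nonneg power_mult_distrib power_divide)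
qed

subsection \<open>Spectra of symmetric operators\<close>

text \<open>Compactness of the unit sphere gives a minimizer, and stationarity makes it an
  eigenvector. This one variational fact yields both the upper bound by \<open>rho\<close> and the
  lower bound by \<open>rho2\<close> without diagonalizing.\<close>

lemma rayleigh_minimizer:
  fixes f :: "'a::euclidean_space \<Rightarrow> 'a"
  assumes lin: "linear f" and adj: "\<And>x y. x \<bullet> f y = f x \<bullet> y"
    and S: "subspace S" "f ` S \<subseteq> S" "S \<noteq> {0}"
  obtains m v where "v \<in> S" "v \<noteq> 0" "f v = m *\<^sub>R v" "\<And>x. x \<in> S \<Longrightarrow> m * (x \<bullet> x) \<le> x \<bullet> f x"
proof -
  obtain z where z: "z \<in> S" "z \<noteq> 0" using S subspace_0 by blast
  have ne: "S \<inter> sphere 0 1 \<noteq> {}"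
    using z subspace_scale[OF S(1), of z "1 / norm z"] by (auto intro!: exI[of _ "(1 / norm z) *\<^sub>R z"])
  have co: "compact (S \<inter> sphere 0 1)"
    by (intro closed_Int_compact closed_subspace S compact_sphere)
  have "continuous_on (S \<inter> sphere 0 1) (\<lambda>x. x \<bullet> f x)"
    by (intro continuous_intros linear_continuous_on linear_conv_bounded_linear[THEN iffD1] lin)
  from continuous_attains_inf[OF co ne this]
  obtain v where v: "v \<in> S" "norm v = 1" and min: "\<And>x. x \<in> S \<Longrightarrow> norm x = 1 \<Longrightarrow> v \<bullet> f v \<le> x \<bullet> f x"
    by auto
  define m where "m = v \<bullet> f v"
  have le: "m * (x \<bullet> x) \<le> x \<bullet> f x" if "x \<in> S" for x
  proof (cases "x = 0")
    case False
    have "m \<le> ((1 / norm x) *\<^sub>R x) \<bullet> f ((1 / norm x) *\<^sub>R x)"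
      unfolding m_def using False that S(1) by (intro min) (auto intro: subspace_scale)
    also have "\<dots> = (x \<bullet> f x) / (x \<bullet> x)"
      using lin by (simp add: linear_scale power2_norm_eq_inner[symmetric] power2_eq_square)
    finally show ?thesis using False by (simp add: field_simps)
  qed (simp add: lin linear_0)
  define r where "r = f v - m *\<^sub>R v"
  have rS: "r \<in> S"
    unfolding r_def using v S by (intro subspace_diff subspace_scale) auto
  have vv: "v \<bullet> v = 1" using v by (simp add: power2_norm_eq_inner[symmetric])
  \<comment> \<open>Moving from \<open>v\<close> to \<open>v + t *\<^sub>R r\<close> has first
    variation \<open>2 * t * (r \<bullet> r)\<close>; nonnegativity for both signs of
    \<open>t\<close> will force the residual to vanish.\<close>
  have lower: "0 \<le> t\<^sup>2 * (r \<bullet> f r - m * (r \<bullet> r)) + 2 * t * (r \<bullet> r)" for t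
  proof -
    have "v + t *\<^sub>R r \<in> S" by (intro subspace_add subspace_scale S v rS)
    from le[OF this]
    have "m * (v \<bullet> v + 2 * t * (r \<bullet> v) + t\<^sup>2 * (r \<bullet> r)) \<le> v \<bullet> f v + 2 * t * (r \<bullet> f v) + t\<^sup>2 * (r \<bullet> f r)"
      using adj[of v r]
      by (simp add: linear_add linear_scale lin inner_simps inner_commute power2_eq_square algebra_simps)
    moreover have "r \<bullet> f v = r \<bullet> r + m * (r \<bullet> v)"
      by (simp add: r_def inner_simps)
    ultimately show ?thesis by (simp add: m_def[symmetric] vv algebra_simps)
  qed
  have "r \<bullet> r = 0"
  proof (rule ccontr)
    assume ne0: "r \<bullet> r \<noteq> 0"
    then have pos: "r \<bullet> r > 0" by (simp add: inner_gt_zero_iff)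
    \<comment> \<open>The added 1 keeps \<open>C\<close> positive; with
      \<open>t = - (r \<bullet> r) / C\<close> the linear term beats the quadratic one.\<close>
    define C where "C = \<bar>r \<bullet> f r - m * (r \<bullet> r)\<bar> + 1"
    have C: "C > 0" "r \<bullet> f r - m * (r \<bullet> r) \<le> C" unfolding C_def by auto
    have "0 \<le> (r \<bullet> r / C)\<^sup>2 * (r \<bullet> f r - m * (r \<bullet> r)) - 2 * (r \<bullet> r)\<^sup>2 / C"
      using lower[of "- (r \<bullet> r) / C"] by (simp add: power2_eq_square)
    also have "\<dots> \<le> (r \<bullet> r / C)\<^sup>2 * C - 2 * (r \<bullet> r)\<^sup>2 / C"
      using C(2) by (intro diff_right_mono mult_left_mono) auto
    also have "\<dots> = - (r \<bullet> r)\<^sup>2 / C"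
      using C(1) by (simp add: field_simps power2_eq_square)
    also have "\<dots> < 0" using C(1) pos by simp
    finally show False by simp
  qed
  then have "f v = m *\<^sub>R v" by (simp add: r_def)
  moreover have "v \<noteq> 0" using v by auto
  ultimately show ?thesis using that v le by blast
qed

text \<open>Needed so that \<open>Max\<close> in \<open>rho\<close> and \<open>Min\<close> in
  \<open>rho2\<close> really bound the spectrum. One eigenvector per eigenvalue gives an orthogonal,
  hence independent, hence finite family.\<close>

lemma finite_eigenvalues_symmetric:
  fixes M :: "real^'n^'n"
  assumes sym: "\<And>i j. M $ i $ j = M $ j $ i"
  shows "finite (eigenvalues M)"
proof -
  have adj: "x \<bullet> (M *v y) = (M *v x) \<bullet> y" for x y :: "real^'n"
  proof -
    have "transpose M = M" by (simp add: transpose_def vec_eq_iff sym)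
    then show ?thesis by (simp add: dot_lmul_matrix vector_transpose_matrix[symmetric])
  qed
  define V where "V \<mu> = (SOME v. v \<noteq> 0 \<and> M *v v = \<mu> *\<^sub>R v)" for \<mu>
  have V: "V \<mu> \<noteq> 0 \<and> M *v V \<mu> = \<mu> *\<^sub>R V \<mu>" if "\<mu> \<in> eigenvalues M" for \<mu>
    using that unfolding eigenvalues_def V_def mem_Collect_eq by (rule someI_ex)
  have orth: "V a \<bullet> V b = 0" if "a \<in> eigenvalues M" "b \<in> eigenvalues M" "a \<noteq> b" for a b
    using adj[of "V a" "V b"] V[OF that(1)] V[OF that(2)] that(3) by simp
  have inj: "inj_on V (eigenvalues M)"
    using orth V by (metis inj_onI inner_eq_zero_iff)
  have "pairwise orthogonal (V ` eigenvalues M)"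
    using orth by (auto simp: pairwise_def orthogonal_def)
  moreover have "0 \<notin> V ` eigenvalues M" using V by auto
  ultimately have "independent (V ` eigenvalues M)"
    by (rule pairwise_orthogonal_independent)
  then show ?thesis
    using inj finite_imageD independent_imp_finite by blast
qed

lemma positive_definite_inverse:
  fixes M :: "'a::euclidean_space \<Rightarrow> 'a"
  assumes lin: "linear M" and adj: "\<And>x y. x \<bullet> M y = M x \<bullet> y"
    and r: "r > 0" "\<And>x. r * (x \<bullet> x) \<le> x \<bullet> M x"
  obtains Q where "linear Q" "\<And>x. Q (M x) = x" "\<And>x y. x \<bullet> Q y = Q x \<bullet> y"
    "\<And>x. 0 \<le> x \<bullet> Q x" "\<And>x. x \<bullet> Q x \<le> (x \<bullet> x) / r"
proof -
  have "inj M"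
    unfolding linear_injective_0[OF lin]
  proof (intro allI impI)
    fix x assume "M x = 0"
    with r(2)[of x] have "r * (x \<bullet> x) \<le> 0" by simp
    then show "x = 0" using r(1) by (metis inner_eq_zero_iff inner_ge_zero linorder_not_less mult_pos_pos order_le_less)
  qed
  from linear_injective_isomorphism[OF lin this]
  obtain Q where Q: "linear Q" "\<And>x. Q (M x) = x" "\<And>x. M (Q x) = x" by auto
  have QM: "x \<bullet> Q x = Q x \<bullet> M (Q x)" for x by (simp add: Q inner_commute)
  show ?thesis
  proof
    show "linear Q" "\<And>x. Q (M x) = x" using Q by auto
    show "x \<bullet> Q y = Q x \<bullet> y" for x y using adj[of "Q x" "Q y"] by (simp add: Q)
    show "0 \<le> x \<bullet> Q x" for x
      using r(2)[of "Q x"] r(1) unfolding QM by (smt (verit) inner_ge_zero mult_nonneg_nonneg)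
    show "x \<bullet> Q x \<le> (x \<bullet> x) / r" for x
    proof -
      \<comment> \<open>Expanding this square and using
        \<open>r * (Q x \<bullet> Q x) \<le> x \<bullet> Q x\<close>, which is coercivity at
        \<open>Q x\<close>, bounds the inverse without operator square roots.\<close>
      have "0 \<le> (x - r *\<^sub>R Q x) \<bullet> (x - r *\<^sub>R Q x)" by simp
      also have "\<dots> = x \<bullet> x - 2 * r * (x \<bullet> Q x) + r * (r * (Q x \<bullet> Q x))"
        by (simp add: inner_simps inner_commute algebra_simps)
      also have "\<dots> \<le> x \<bullet> x - 2 * r * (x \<bullet> Q x) + r * (x \<bullet> Q x)"
        using r(2)[of "Q x"] r(1) unfolding QM[symmetric] by simp
      finally show ?thesis using r(1) by (simp add: field_simps)
    qed
  qed
qed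

subsection \<open>Graph Laplacians on block vectors\<close>

text \<open>The Kronecker product of \<open>M\<close> with the identity on \<open>real^'p\<close>.
  Block vectors form a Euclidean space, so \<open>inner\<close> and the compactness argument apply
  to stacked states directly.\<close>

definition block_mult :: "real^'n^'n \<Rightarrow> real^'p^'n \<Rightarrow> real^'p^'n" where
  "block_mult M Z = (\<chi> i. \<Sum>j\<in>UNIV. M $ i $ j *\<^sub>R Z $ j)"

definition center :: "real^'p^'n \<Rightarrow> real^'p^'n" where
  "center Z = (\<chi> i. Z $ i - avg (($) Z))"

lemma linear_block_mult: "linear (block_mult M)"
  by (rule linearI)
    (simp_all add: block_mult_def vec_eq_iff sum.distrib sum_distrib_left algebra_simps)

lemma avg_diff: "avg (\<lambda>i. a i - b i) = avg a - avg b"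
  by (simp add: avg_def sum_subtractf scaleR_diff_right)

lemma avg_nth_add: "avg (($) (a + b)) = avg (($) a) + avg (($) b)"
  by (simp add: avg_def sum.distrib scaleR_add_right)

lemma avg_nth_scaleR: "avg (($) (c *\<^sub>R a)) = c *\<^sub>R avg (($) a)"
  by (simp add: avg_def scaleR_sum_right[symmetric] mult.commute)

lemma linear_center: "linear center"
  by (rule linearI)
    (simp_all add: center_def vec_eq_iff avg_nth_add avg_nth_scaleR algebra_simps)

lemma card_scaleR_avg: "real CARD('n) *\<^sub>R avg a = (\<Sum>i\<in>UNIV. a i)"
  for a :: "'n::finite \<Rightarrow> real^'p"
  by (simp add: avg_def)

lemma avg_center: "avg (($) (center Z)) = 0"
  by (simp add: center_def avg_def sum_subtractf scaleR_diff_right sum_constant_scaleR del: sum_constant)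

lemma center_eq_self: "avg (($) Z) = 0 \<Longrightarrow> center Z = Z"
  by (simp add: center_def vec_eq_iff)

text \<open>Centering is an orthogonal projection: \<open>Y - center Y\<close> has the same block
  for every agent, while the blocks of \<open>center Z\<close> sum to zero.\<close>

lemma inner_center: "center Z \<bullet> Y = center Z \<bullet> center Y"
proof -
  have "center Z \<bullet> (Y - center Y) = (\<Sum>i\<in>UNIV. center Z $ i) \<bullet> avg (($) Y)"
    by (simp add: inner_vec_def[of "center Z"] center_def[of Y] inner_sum_left)
  also have "\<dots> = 0"
    using card_scaleR_avg[of "($) (center Z)"] by (simp add: avg_center)
  finally show ?thesis by (simp add: inner_diff_right)
qed

text \<open>Pythagoras for consensus part and deviation. Dropping either nonnegative summand gives
  \<open>knorm2_le\<close> and \<open>card_norm_avg_le\<close>, which turn per-agent errors into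
  bounds on centered and averaged quantities.\<close>

lemma sum_norm_decompose:
  fixes a :: "'n::finite \<Rightarrow> real^'p"
  shows "(\<Sum>i\<in>UNIV. (norm (a i))\<^sup>2) = (\<Sum>i\<in>UNIV. (norm (a i - avg a))\<^sup>2) + real CARD('n) * (norm (avg a))\<^sup>2"
proof -
  have "(norm (a i - avg a))\<^sup>2 = (norm (a i))\<^sup>2 - 2 * (a i \<bullet> avg a) + (norm (avg a))\<^sup>2" for i
    by (simp add: power2_norm_eq_inner inner_diff_left inner_diff_right inner_commute)
  then have "(\<Sum>i\<in>UNIV. (norm (a i - avg a))\<^sup>2)
      = (\<Sum>i\<in>UNIV. (norm (a i))\<^sup>2) - 2 * ((\<Sum>i\<in>UNIV. a i) \<bullet> avg a) + real CARD('n) * (norm (avg a))\<^sup>2"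
    by (simp add: sum_subtractf sum.distrib sum_distrib_left[symmetric] inner_sum_left)
  also have "(\<Sum>i\<in>UNIV. a i) \<bullet> avg a = real CARD('n) * (norm (avg a))\<^sup>2"
    by (simp only: card_scaleR_avg[of a, symmetric] inner_scaleR_left power2_norm_eq_inner)
  finally show ?thesis by simp
qed

lemma knorm2_eq: "knorm2 z = center (\<chi> i. z i) \<bullet> center (\<chi> i. z i)"
  by (simp add: knorm2_def inner_vec_def[of "center _" "center _"] power2_norm_eq_inner)
    (simp add: center_def vec_lambda_inverse)

lemma knorm2_le: "knorm2 z \<le> (\<Sum>i\<in>UNIV. (norm (z i))\<^sup>2)"
  unfolding sum_norm_decompose[of z] knorm2_def by simp

lemma card_norm_avg_le:
  fixes a :: "'n::finite \<Rightarrow> real^'p"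
  shows "real CARD('n) * (norm (avg a))\<^sup>2 \<le> (\<Sum>i\<in>UNIV. (norm (a i))\<^sup>2)"
  unfolding sum_norm_decompose[of a] by (simp add: sum_nonneg)

lemma block_mult_laplacian:
  "block_mult (laplacian A) Z $ i = (\<Sum>j\<in>UNIV. A $ i $ j *\<^sub>R (Z $ i - Z $ j))"
proof -
  have "block_mult (laplacian A) Z $ i
      = laplacian A $ i $ i *\<^sub>R Z $ i + (\<Sum>j\<in>UNIV - {i}. laplacian A $ i $ j *\<^sub>R Z $ j)"
    by (simp add: block_mult_def sum.remove[of UNIV i])
  also have "(\<Sum>j\<in>UNIV - {i}. laplacian A $ i $ j *\<^sub>R Z $ j) = (\<Sum>j\<in>UNIV - {i}. - A $ i $ j *\<^sub>R Z $ j)"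
    by (rule sum.cong) (auto simp: laplacian_def)
  also have "laplacian A $ i $ i *\<^sub>R Z $ i = (\<Sum>j\<in>UNIV - {i}. A $ i $ j *\<^sub>R Z $ i)"
    by (simp add: laplacian_def scaleR_sum_left)
  finally have "block_mult (laplacian A) Z $ i = (\<Sum>j\<in>UNIV - {i}. A $ i $ j *\<^sub>R (Z $ i - Z $ j))"
    by (simp add: sum.distrib[symmetric] scaleR_diff_right sum_subtractf sum_negf)
  then show ?thesis by (simp add: sum.remove[of UNIV i])
qed

lemma block_mult_laplacian_center:
  "block_mult (laplacian A) (center Z) = block_mult (laplacian A) Z"
  by (simp add: vec_eq_iff block_mult_laplacian) (simp add: center_def)

section \<open>Quadratic form and spectrum of the graph Laplacian\<close>

locale weighted_graph =
  fixes A :: "real^'n^'n"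
  assumes graph: "weighted_undirected_graph A"
begin

abbreviation Lap :: "real^'p^'n \<Rightarrow> real^'p^'n" where
  "Lap \<equiv> block_mult (laplacian A)"

lemma weight_sym: "A $ i $ j = A $ j $ i" and weight_nonneg: "0 \<le> A $ i $ j"
  using graph by (auto simp: weighted_undirected_graph_def)

lemma laplacian_sym: "laplacian A $ i $ j = laplacian A $ j $ i"
  by (simp add: laplacian_def weight_sym)

text \<open>The Dirichlet form of the graph. Exchanging \<open>i\<close> and \<open>j\<close> and
  using symmetric weights gives a second expression for the same sum; averaging the two symmetrizes
  it. Self-adjointness, nonnegativity and vanishing on consensus all follow from this form.\<close>

lemma inner_Lap:
  "Z \<bullet> Lap Y = (1/2) * (\<Sum>i\<in>UNIV. \<Sum>j\<in>UNIV. A $ i $ j * ((Z $ i - Z $ j) \<bullet> (Y $ i - Y $ j)))"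
proof -
  have 1: "Z \<bullet> Lap Y = (\<Sum>i\<in>UNIV. \<Sum>j\<in>UNIV. A $ i $ j * (Z $ i \<bullet> (Y $ i - Y $ j)))"
    by (simp add: inner_vec_def[of Z] block_mult_laplacian inner_sum_right)
  also have "\<dots> = (\<Sum>j\<in>UNIV. \<Sum>i\<in>UNIV. A $ i $ j * (Z $ i \<bullet> (Y $ i - Y $ j)))"
    by (rule sum.swap)
  also have "\<dots> = (\<Sum>i\<in>UNIV. \<Sum>j\<in>UNIV. A $ i $ j * (- Z $ j \<bullet> (Y $ i - Y $ j)))"
    by (intro sum.cong refl) (simp add: weight_sym inner_diff_right algebra_simps)
  finally have "2 * (Z \<bullet> Lap Y)
      = (\<Sum>i\<in>UNIV. \<Sum>j\<in>UNIV. A $ i $ j * (Z $ i \<bullet> (Y $ i - Y $ j)) + A $ i $ j * (- Z $ j \<bullet> (Y $ i - Y $ j)))"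
    using 1 by (simp only: sum.distrib mult_2)
  also have "\<dots> = (\<Sum>i\<in>UNIV. \<Sum>j\<in>UNIV. A $ i $ j * ((Z $ i - Z $ j) \<bullet> (Y $ i - Y $ j)))"
    by (intro sum.cong refl) (simp add: inner_diff_left algebra_simps)
  finally show ?thesis by simp
qed

lemma Lap_adjoint: "Z \<bullet> Lap Y = Lap Z \<bullet> Y"
  unfolding inner_commute[of "Lap Z" Y] inner_Lap by (simp only: inner_commute)

lemma inner_Lap_nonneg: "0 \<le> Z \<bullet> Lap Z"
  unfolding inner_Lap by (intro mult_nonneg_nonneg sum_nonneg weight_nonneg) auto

lemma avg_Lap: "avg (($) (Lap Z)) = 0"
proof -
  have "avg (($) (Lap Z)) \<bullet> u = 0" for u
  proof -
    \<comment> \<open>Testing against the consensus vector with block \<open>u\<close> annihilates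
      every difference in the Dirichlet form.\<close>
    have "(\<Sum>i\<in>UNIV. Lap Z $ i) \<bullet> u = (\<chi> i. u) \<bullet> Lap Z"
      by (simp add: inner_vec_def[of "\<chi> i. u"] inner_sum_right inner_commute[of _ u])
    also have "\<dots> = 0" by (simp add: inner_Lap)
    finally show ?thesis by (simp add: avg_def)
  qed
  then show ?thesis by (metis inner_eq_zero_iff)
qed

lemma center_Lap: "center (Lap Z) = Lap Z"
  by (rule center_eq_self) (rule avg_Lap)

lemma finite_eigenvalues: "finite (eigenvalues (laplacian A))"
  by (rule finite_eigenvalues_symmetric) (rule laplacian_sym)

text \<open>Transfers eigenvalues from stacked vectors to the agent-level matrix used by
  \<open>rho\<close> and \<open>rho2\<close>: \<open>Lap\<close> acts on each coordinate slice
  separately, and some slice of \<open>V\<close> is nonzero.\<close>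

lemma eigenvalue_block:
  assumes "V \<noteq> 0" "Lap V = m *\<^sub>R V"
  shows "m \<in> eigenvalues (laplacian A)"
proof -
  obtain i l where il: "V $ i $ l \<noteq> 0"
    using assms(1) by (auto simp: vec_eq_iff)
  define u where "u = (\<chi> i. V $ i $ l)"
  have "u \<noteq> 0" using il by (auto simp: u_def vec_eq_iff)
  moreover have "laplacian A *v u = m *\<^sub>R u"
    using assms(2) by (simp add: vec_eq_iff u_def matrix_vector_mult_def block_mult_def)
  ultimately show ?thesis by (auto simp: eigenvalues_def)
qed

lemma inner_Lap_le_rho:
  fixes Z :: "real^'p^'n"
  shows "Z \<bullet> Lap Z \<le> rho (laplacian A) * (Z \<bullet> Z)"
proof -
  obtain m and V :: "real^'p^'n" where V: "V \<noteq> 0" "- Lap V = m *\<^sub>R V"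
    and le: "\<And>X :: real^'p^'n. m * (X \<bullet> X) \<le> - (X \<bullet> Lap X)"
  \<comment> \<open>Minimizing for \<open>- Lap\<close> is maximizing for \<open>Lap\<close>; the
    maximum is an eigenvalue, hence at most \<open>rho\<close>.\<close>
  proof (rule rayleigh_minimizer[of "\<lambda>X :: real^'p^'n. - Lap X" UNIV])
    show "linear (\<lambda>X :: real^'p^'n. - Lap X)"
      by (intro linear_compose_neg linear_block_mult)
    show "UNIV \<noteq> {0 :: real^'p^'n}" by (rule UNIV_not_singleton)
    show "range (\<lambda>X :: real^'p^'n. - Lap X) \<subseteq> UNIV" by simp
    fix m and V :: "real^'p^'n"
    assume "V \<noteq> 0" "- Lap V = m *\<^sub>R V" "\<And>X :: real^'p^'n. X \<in> UNIV \<Longrightarrow> m * (X \<bullet> X) \<le> X \<bullet> - Lap X"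
    then show thesis by (intro that[of V m]) simp_all
  qed (simp_all add: Lap_adjoint)
  have "Lap V = (- m) *\<^sub>R V" using V(2) by (metis minus_minus scaleR_minus_left)
  then have "- m \<in> eigenvalues (laplacian A)" using V(1) eigenvalue_block by blast
  then have "- m \<le> rho (laplacian A)"
    unfolding rho_def by (intro Max_ge finite_eigenvalues)
  then have "(- m) * (Z \<bullet> Z) \<le> rho (laplacian A) * (Z \<bullet> Z)"
    by (rule mult_right_mono) simp
  with le[of Z] show ?thesis by simp
qed

end

locale connected_graph = weighted_graph A for A :: "real^'n^'n" +
  assumes conn: "graph_connected A" and card: "CARD('n) \<ge> 2"
begin

text \<open>All summands of the Dirichlet form are nonnegative, so a zero total makes blocks agree
  across each edge, and connectedness carries this along paths.\<close>

lemma inner_Lap_eq_0D: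
  assumes "Z \<bullet> Lap Z = 0"
  shows "Z $ i = Z $ j"
proof -
  have edge: "Z $ a = Z $ b" if "0 < A $ a $ b" for a b
  proof -
    have "(\<Sum>i\<in>UNIV. \<Sum>j\<in>UNIV. A $ i $ j * ((Z $ i - Z $ j) \<bullet> (Z $ i - Z $ j))) = 0"
      using assms unfolding inner_Lap by simp
    then have "A $ a $ b * ((Z $ a - Z $ b) \<bullet> (Z $ a - Z $ b)) = 0"
      by (subst (asm) sum_nonneg_eq_0_iff; (subst (asm) sum_nonneg_eq_0_iff)?)
        (auto intro!: sum_nonneg mult_nonneg_nonneg weight_nonneg simp: sum_nonneg_eq_0_iff weight_nonneg)
    then show ?thesis using that by simp
  qed
  have "(i, j) \<in> {(a, b). a \<noteq> b \<and> 0 < A $ a $ b}\<^sup>*"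
    using conn by (simp add: graph_connected_def)
  then show ?thesis
    by (induction rule: rtrancl_induct) (auto simp: edge)
qed

text \<open>The minimization runs over mean-zero block vectors, an invariant subspace. A minimum of
  0 would make the minimizer a consensus vector of mean zero, that is, zero.\<close>

lemma rayleigh_positive:
  obtains m where "m \<in> eigenvalues (laplacian A)" "0 < m"
    "\<And>Z :: real^'p^'n. m * (center Z \<bullet> center Z) \<le> Z \<bullet> Lap Z"
proof -
  define S :: "(real^'p^'n) set" where "S = {Z. avg (($) Z) = 0}"
  have S: "subspace S"
    unfolding S_def subspace_def by (simp add: avg_nth_add avg_nth_scaleR) (simp add: avg_def)
  \<comment> \<open>With one agent the Laplacian is zero and has no positive eigenvalue. Two
    distinct agents give \<open>Z0\<close>, a nonzero vector of mean zero.\<close>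
  obtain a b :: 'n where ab: "a \<noteq> b"
    using card card_le_Suc0_iff_eq[of "UNIV :: 'n set"] by auto
  define Z0 :: "real^'p^'n" where "Z0 = axis a 1 - axis b 1"
  have "avg (($) Z0) = 0"
    by (simp add: Z0_def avg_def axis_def sum_subtractf sum.delta)
  moreover have "Z0 \<noteq> 0"
    using ab by (auto simp: Z0_def axis_def vec_eq_iff split: if_splits intro!: exI[of _ a])
  ultimately have S0: "S \<noteq> {0}" by (auto simp: S_def)
  obtain m V where V: "V \<in> S" "V \<noteq> 0" "Lap V = m *\<^sub>R V"
    and le: "\<And>X. X \<in> S \<Longrightarrow> m * (X \<bullet> X) \<le> X \<bullet> Lap X"
  proof (rule rayleigh_minimizer[OF linear_block_mult Lap_adjoint S _ S0])
    show "Lap ` S \<subseteq> S" by (auto simp: S_def avg_Lap)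
  qed (rule that)
  have VV: "V \<bullet> V > 0" using V(2) by (simp add: inner_gt_zero_iff)
  have "m \<noteq> 0"
  proof
    assume "m = 0"
    then have "V $ i = V $ j" for i j using V(3) by (intro inner_Lap_eq_0D) simp
    then have "V = (\<chi> i. V $ a)" by (simp add: vec_eq_iff)
    then have "avg (($) V) = avg (\<lambda>i::'n. V $ a)" by (metis vec_lambda_beta)
    also have "\<dots> = V $ a" by (simp add: avg_def sum_constant_scaleR del: sum_constant)
    finally have "V $ a = 0" using V(1) by (simp add: S_def)
    then show False using V(2) \<open>V = (\<chi> i. V $ a)\<close> by (metis zero_vec_def)
  qed
  moreover have "m * (V \<bullet> V) \<ge> 0" using inner_Lap_nonneg[of V] V(3) by simp
  ultimately have "0 < m" using VV by (simp add: zero_le_mult_iff)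
  moreover have "m \<in> eigenvalues (laplacian A)" using V eigenvalue_block by blast
  moreover have "m * (center Z \<bullet> center Z) \<le> Z \<bullet> Lap Z" for Z :: "real^'p^'n"
  proof -
    have "m * (center Z \<bullet> center Z) \<le> center Z \<bullet> Lap (center Z)"
      by (intro le) (simp add: S_def avg_center)
    also have "\<dots> = Lap Z \<bullet> center Z" by (simp add: block_mult_laplacian_center inner_commute)
    also have "\<dots> = Z \<bullet> Lap (center Z)" by (simp add: Lap_adjoint)
    finally show ?thesis by (simp add: block_mult_laplacian_center)
  qed
  ultimately show ?thesis using that by blast
qed

lemma finite_positive_eigenvalues: "finite {\<mu>\<in>eigenvalues (laplacian A). 0 < \<mu>}"
  using finite_eigenvalues by simp

lemma rho2_in: "rho2 (laplacian A) \<in> {\<mu>\<in>eigenvalues (laplacian A). 0 < \<mu>}"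
  unfolding rho2_def
proof (rule Min_in[OF finite_positive_eigenvalues])
  show "{\<mu>\<in>eigenvalues (laplacian A). 0 < \<mu>} \<noteq> {}"
    \<comment> \<open>The goal mentions no block dimension, so one has to be chosen.\<close>
    by (rule rayleigh_positive[where 'p = 1]) auto
qed

lemma rho2_pos: "0 < rho2 (laplacian A)"
  using rho2_in by simp

lemma rho_pos: "0 < rho (laplacian A)"
  using rho2_in Max_ge[OF finite_eigenvalues, of "rho2 (laplacian A)"] unfolding rho_def by auto

lemma rho2_le_inner_Lap:
  fixes Z :: "real^'p^'n"
  shows "rho2 (laplacian A) * (center Z \<bullet> center Z) \<le> Z \<bullet> Lap Z"
proof -
  obtain m where m: "m \<in> eigenvalues (laplacian A)" "0 < m"
    and le: "\<And>Z :: real^'p^'n. m * (center Z \<bullet> center Z) \<le> Z \<bullet> Lap Z"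
    using rayleigh_positive by blast
  have "rho2 (laplacian A) \<le> m"
    unfolding rho2_def using m by (intro Min_le finite_positive_eigenvalues) simp
  then have "rho2 (laplacian A) * (center Z \<bullet> center Z) \<le> m * (center Z \<bullet> center Z)"
    by (rule mult_right_mono) simp
  with le[of Z] show ?thesis by linarith
qed

text \<open>Semidefiniteness at \<open>r *\<^sub>R Z - Lap Z\<close>, together with the bound by
  \<open>rho\<close> at \<open>Lap Z\<close> and at \<open>Z\<close>, replaces a spectral
  decomposition.\<close>

lemma Lap_norm_le:
  fixes Z :: "real^'p^'n"
  shows "Lap Z \<bullet> Lap Z \<le> (rho (laplacian A))\<^sup>2 * (Z \<bullet> Z)"
proof -
  define r where "r = rho (laplacian A)"
  have r: "r > 0" unfolding r_def by (rule rho_pos)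
  have "0 \<le> (r *\<^sub>R Z - Lap Z) \<bullet> Lap (r *\<^sub>R Z - Lap Z)" by (rule inner_Lap_nonneg)
  also have "\<dots> = r\<^sup>2 * (Z \<bullet> Lap Z) - 2 * r * (Lap Z \<bullet> Lap Z) + Lap Z \<bullet> Lap (Lap Z)"
    using Lap_adjoint[of Z "Lap Z"]
    by (simp add: linear_diff linear_scale linear_block_mult inner_diff_left inner_diff_right
        power2_eq_square algebra_simps)
  also have "\<dots> \<le> r\<^sup>2 * (Z \<bullet> Lap Z) - 2 * r * (Lap Z \<bullet> Lap Z) + r * (Lap Z \<bullet> Lap Z)"
    using inner_Lap_le_rho[of "Lap Z"] by (simp add: r_def)
  finally have "r * (Lap Z \<bullet> Lap Z) \<le> r * (r * (Z \<bullet> Lap Z))"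
    by (simp add: power2_eq_square)
  then have "Lap Z \<bullet> Lap Z \<le> r * (Z \<bullet> Lap Z)" using r by simp
  also have "\<dots> \<le> r * (r * (Z \<bullet> Z))"
    using inner_Lap_le_rho[of Z] r by (simp add: r_def)
  finally show ?thesis by (simp add: r_def power2_eq_square)
qed

text \<open>\<open>Lap\<close> annihilates consensus vectors, so recovering the centered part is the
  most an inverse can do. It suffices because the Lyapunov function applies \<open>Q\<close> to
  centered states.\<close>

lemma Lap_inverse:
  obtains Q :: "real^'p^'n \<Rightarrow> real^'p^'n"
  where "linear Q" "\<And>Z. Q (Lap Z) = center Z" "\<And>x y. x \<bullet> Q y = Q x \<bullet> y"
    "\<And>x. 0 \<le> x \<bullet> Q x" "\<And>x. x \<bullet> Q x \<le> (x \<bullet> x) / rho2 (laplacian A)"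
proof -
  define r where "r = rho2 (laplacian A)"
  \<comment> \<open>Shifting the Laplacian by \<open>r\<close> on the consensus directions makes \<open>M\<close> positive definite with
    the same lower bound \<open>r\<close> everywhere.\<close>
  define M :: "real^'p^'n \<Rightarrow> real^'p^'n" where "M Z = Lap Z + r *\<^sub>R (Z - center Z)" for Z
  have lin: "linear M"
    unfolding M_def
    by (intro linear_compose_add linear_block_mult linear_compose_scale_right linear_compose_sub
        linear_center linear_id[unfolded id_def])
  have adj: "x \<bullet> M y = M x \<bullet> y" for x y
  proof -
    have "x \<bullet> center y = center x \<bullet> y"
      using inner_center[of x y] inner_center[of y x] by (simp add: inner_commute)
    then show ?thesis by (simp add: M_def inner_simps Lap_adjoint)
  qed
  have "r * (x \<bullet> x) \<le> x \<bullet> M x" for x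
  proof -
    have "x \<bullet> center x = center x \<bullet> center x" by (metis inner_center inner_commute)
    then show ?thesis
      using rho2_le_inner_Lap[of x] by (simp add: M_def inner_simps r_def algebra_simps)
  qed
  from positive_definite_inverse[OF lin adj _ this]
  obtain Q where Q: "linear Q" "\<And>x. Q (M x) = x" "\<And>x y. x \<bullet> Q y = Q x \<bullet> y"
    "\<And>x. 0 \<le> x \<bullet> Q x" "\<And>x. x \<bullet> Q x \<le> (x \<bullet> x) / r"
    using rho2_pos unfolding r_def by blast
  have "Q (Lap Z) = center Z" for Z
  proof -
    have "M (center Z) = Lap Z"
      by (simp add: M_def block_mult_laplacian_center center_eq_self avg_center)
    then show ?thesis by (metis Q(2))
  qed
  then show ?thesis using that Q unfolding r_def by blast
qed

end

subsection \<open>The primal-dual Lyapunov function\<close>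

lemma inner_young: "0 \<le> s * s * (x \<bullet> x) + 2 * s * t * (x \<bullet> y) + t * t * (y \<bullet> y)"
  for x y :: "'a::real_inner"
proof -
  have "0 \<le> (s *\<^sub>R x + t *\<^sub>R y) \<bullet> (s *\<^sub>R x + t *\<^sub>R y)" by simp
  also have "\<dots> = s * s * (x \<bullet> x) + 2 * s * t * (x \<bullet> y) + t * t * (y \<bullet> y)"
    by (simp add: inner_simps inner_commute algebra_simps)
  finally show ?thesis .
qed

text \<open>Eight squares remove the six mixed products: \<open>1\<close> and \<open>2\<close> the
  two contributions to \<open>z \<bullet> w\<close>, \<open>3\<close> and \<open>4\<close> those to
  \<open>z \<bullet> d\<close>, and \<open>5\<close> to \<open>8\<close> one product each. The
  diagonal terms left over explain \<open>2 * \<beta>\<^sup>2 + 1/2\<close> and the other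
  coefficients.\<close>

lemma cross_term_bound:
  fixes z w d e :: "'a::real_inner" and \<alpha> \<beta> \<eta> :: real
  assumes "\<beta> > 0"
  defines "y \<equiv> \<alpha> *\<^sub>R z + \<beta> *\<^sub>R w + d" and "u \<equiv> (\<eta> * \<beta>) *\<^sub>R z + (1 / \<beta>) *\<^sub>R e"
  shows "\<eta>\<^sup>2 / 2 * (y \<bullet> y) - \<eta> * (y \<bullet> u)
    \<le> \<eta>\<^sup>2 * (2 * \<alpha>\<^sup>2 + \<beta>\<^sup>2 - \<alpha> * \<beta>) * (z \<bullet> z) + \<eta>\<^sup>2 * (2 * \<beta>\<^sup>2 + 1/2) * (w \<bullet> w)
      + 5/2 * \<eta>\<^sup>2 * (d \<bullet> d) + (1/2 + 1 / \<beta>\<^sup>2) * (e \<bullet> e)"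
proof -
  define c where "c = 1 / \<beta>"
  have \<beta>c: "\<beta> * c = 1" using assms(1) by (simp add: c_def)
  have 1: "0 \<le> \<eta>\<^sup>2 * (\<alpha> * \<alpha> * (z \<bullet> z) + 2 * \<alpha> * - \<beta> * (z \<bullet> w) + - \<beta> * - \<beta> * (w \<bullet> w))"
    by (intro mult_nonneg_nonneg inner_young) simp
  have 2: "0 \<le> \<eta>\<^sup>2 * (\<beta> * \<beta> * (z \<bullet> z) + 2 * \<beta> * \<beta> * (z \<bullet> w) + \<beta> * \<beta> * (w \<bullet> w))"
    by (intro mult_nonneg_nonneg inner_young) simp
  have 3: "0 \<le> \<eta>\<^sup>2 * (\<alpha> * \<alpha> * (z \<bullet> z) + 2 * \<alpha> * - 1 * (z \<bullet> d) + - 1 * - 1 * (d \<bullet> d))"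
    by (intro mult_nonneg_nonneg inner_young) simp
  have 4: "0 \<le> \<eta>\<^sup>2 * (\<beta> * \<beta> * (z \<bullet> z) + 2 * \<beta> * 1 * (z \<bullet> d) + 1 * 1 * (d \<bullet> d))"
    by (intro mult_nonneg_nonneg inner_young) simp
  have 5: "0 \<le> \<eta>\<^sup>2 * (\<beta> * \<beta> * (w \<bullet> w) + 2 * \<beta> * - 1 * (w \<bullet> d) + - 1 * - 1 * (d \<bullet> d))"
    by (intro mult_nonneg_nonneg inner_young) simp
  have 6: "0 \<le> \<eta> * \<eta> * (w \<bullet> w) + 2 * \<eta> * 1 * (w \<bullet> e) + 1 * 1 * (e \<bullet> e)"
    by (rule inner_young)
  have 7: "0 \<le> (\<eta> * \<alpha>) * (\<eta> * \<alpha>) * (z \<bullet> z) + 2 * (\<eta> * \<alpha>) * c * (z \<bullet> e) + c * c * (e \<bullet> e)"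
    by (rule inner_young)
  have 8: "0 \<le> \<eta> * \<eta> * (d \<bullet> d) + 2 * \<eta> * c * (d \<bullet> e) + c * c * (e \<bullet> e)"
    by (rule inner_young)
  have yy: "y \<bullet> y = \<alpha>\<^sup>2 * (z \<bullet> z) + \<beta>\<^sup>2 * (w \<bullet> w) + d \<bullet> d + 2 * \<alpha> * \<beta> * (z \<bullet> w) + 2 * \<alpha> * (z \<bullet> d) + 2 * \<beta> * (w \<bullet> d)"
    by (simp add: y_def inner_simps inner_commute power2_eq_square algebra_simps)
  have yu: "y \<bullet> u = \<eta> * \<alpha> * \<beta> * (z \<bullet> z) + \<eta> * \<beta>\<^sup>2 * (z \<bullet> w) + \<eta> * \<beta> * (z \<bullet> d)
      + \<alpha> * c * (z \<bullet> e) + w \<bullet> e + c * (d \<bullet> e)"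
    using assms(1)
    by (simp add: y_def u_def c_def inner_simps inner_commute power2_eq_square algebra_simps)
  have "2 * (\<eta>\<^sup>2 / 2 * (y \<bullet> y) - \<eta> * (y \<bullet> u))
    \<le> 2 * (\<eta>\<^sup>2 * (2 * \<alpha>\<^sup>2 + \<beta>\<^sup>2 - \<alpha> * \<beta>) * (z \<bullet> z) + \<eta>\<^sup>2 * (2 * \<beta>\<^sup>2 + 1/2) * (w \<bullet> w)
      + 5/2 * \<eta>\<^sup>2 * (d \<bullet> d) + (1/2 + c\<^sup>2) * (e \<bullet> e))"
    using add_mono[OF add_mono[OF add_mono[OF 1 2] add_mono[OF 3 4]] add_mono[OF add_mono[OF 5 6] add_mono[OF 7 8]]]
    unfolding yy yu by (simp add: power2_eq_square algebra_simps)
  then have "\<eta>\<^sup>2 / 2 * (y \<bullet> y) - \<eta> * (y \<bullet> u)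
    \<le> \<eta>\<^sup>2 * (2 * \<alpha>\<^sup>2 + \<beta>\<^sup>2 - \<alpha> * \<beta>) * (z \<bullet> z) + \<eta>\<^sup>2 * (2 * \<beta>\<^sup>2 + 1/2) * (w \<bullet> w)
      + 5/2 * \<eta>\<^sup>2 * (d \<bullet> d) + (1/2 + c\<^sup>2) * (e \<bullet> e)"
    by (rule mult_left_le_imp_le) simp
  then show ?thesis by (simp only: c_def power_divide power_one)
qed

text \<open>Here \<open>z\<close> stands for the Laplacian of \<open>X\<close>, \<open>d\<close> for
  the gradient perturbation and \<open>e\<close> for the drift of the reference gradients. Of the
  graph only \<open>Q z = X\<close> and the spectral bounds enter.\<close>

lemma primal_dual_step:
  fixes L Q :: "'a::real_inner \<Rightarrow> 'a" and X w z d e :: 'a and \<alpha> \<beta> \<eta> r R :: real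
  assumes Q: "linear Q" "\<And>x y. x \<bullet> Q y = Q x \<bullet> y" "\<And>x. 0 \<le> x \<bullet> Q x" "\<And>x. x \<bullet> Q x \<le> (x \<bullet> x) / r"
    and X: "Q z = X" "r * (X \<bullet> X) \<le> X \<bullet> z" "X \<bullet> z \<le> R * (X \<bullet> X)" "z \<bullet> z \<le> R\<^sup>2 * (X \<bullet> X)"
    and pos: "\<beta> > 0" "\<alpha> > \<beta>" "\<eta> > 0" "r > 0"
  defines "V \<equiv> \<lambda>X w. (X \<bullet> X) / 2 + (w \<bullet> Q w + \<alpha> / \<beta> * (w \<bullet> w)) / 2 + X \<bullet> w"
  shows "V (X - \<eta> *\<^sub>R (\<alpha> *\<^sub>R z + \<beta> *\<^sub>R w + d)) (w + (\<eta> * \<beta>) *\<^sub>R z + (1 / \<beta>) *\<^sub>R e)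
    \<le> V X w
      - \<eta> * ((\<alpha> - \<beta>) * r - 1 - \<eta> * (\<beta>\<^sup>2 * R + (2 * \<alpha>\<^sup>2 + \<beta>\<^sup>2) * R\<^sup>2)) * (X \<bullet> X)
      - \<eta> * (\<beta> - 1/2 - \<alpha> / (2 * \<beta>\<^sup>2) - 1 / (2 * \<beta> * r) - \<eta> * (2 * \<beta>\<^sup>2 + 1/2)) * (w \<bullet> w)
      + (\<eta> + 5/2 * \<eta>\<^sup>2) * (d \<bullet> d)
      + ((1 / \<beta>\<^sup>2 + 1 / (2 * \<eta> * \<beta>)) * (1 / r + \<alpha> / \<beta>) + 1 / (2 * \<eta> * \<beta>\<^sup>2) + 1 / \<beta>\<^sup>2 + 1/2) * (e \<bullet> e)"
    (is "V ?X' ?w' \<le> ?rhs")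
proof -
  define P where "P x y = x \<bullet> Q y + \<alpha> / \<beta> * (x \<bullet> y)" for x y
  define y where "y = \<alpha> *\<^sub>R z + \<beta> *\<^sub>R w + d"
  define u where "u = (\<eta> * \<beta>) *\<^sub>R z + (1 / \<beta>) *\<^sub>R e"
  have \<alpha>: "\<alpha> > 0" using pos by linarith
  have Pc: "P x y = P y x" for x y
    using Q(2)[of x y] by (simp add: P_def inner_commute[of x y] inner_commute[of "Q x" y])
  have Padd: "P x (y + y') = P x y + P x y'" for x y y'
    by (simp add: P_def linear_add Q inner_add_right algebra_simps)
  have Pscale: "P x (c *\<^sub>R y) = c * P x y" for x y c
    by (simp add: P_def linear_scale Q algebra_simps)
  have Padd': "P (x + x') y = P x y + P x' y" for x x' y
    using Padd Pc by metis
  have Pscale': "P (c *\<^sub>R x) y = c * P x y" for x y c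
    using Pscale Pc by metis
  have Pnn: "0 \<le> P x x" for x
    using Q(3)[of x] \<alpha> pos by (simp add: P_def)
  have Ple: "P x x \<le> (1 / r + \<alpha> / \<beta>) * (x \<bullet> x)" for x
    using Q(4)[of x] by (simp add: P_def algebra_simps)
  have Pz: "P x z = x \<bullet> X + \<alpha> / \<beta> * (x \<bullet> z)" for x
    by (simp add: P_def X)
  have Py: "0 \<le> s * s * P x x + 2 * s * t * P x y + t * t * P y y" for s t x y
  proof -
    have "0 \<le> P (s *\<^sub>R x + t *\<^sub>R y) (s *\<^sub>R x + t *\<^sub>R y)" by (rule Pnn)
    also have "\<dots> = s * s * P x x + 2 * s * t * P x y + t * t * P y y"
      by (simp add: Padd Padd' Pscale Pscale' Pc[of y x] algebra_simps)
    finally show ?thesis .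
  qed
  have X': "?X' = X - \<eta> *\<^sub>R y" and w': "?w' = w + u" by (simp_all add: y_def u_def)
  \<comment> \<open>\<open>Pwu\<close> contributes \<open>\<eta> * \<beta> * (X \<bullet> w) +
    \<eta> * \<alpha> * (z \<bullet> w)\<close>, which cancels against the matching terms of
    \<open>Xy\<close> and \<open>yw\<close>.\<close>
  have expand: "V ?X' ?w' = V X w - \<eta> * (\<alpha> - \<beta>) * (X \<bullet> z) - \<eta> * \<beta> * (w \<bullet> w) - \<eta> * (X \<bullet> d) - \<eta> * (w \<bullet> d)
      + 1 / \<beta> * P w e + 1 / \<beta> * (X \<bullet> e) + 1/2 * P u u + (\<eta>\<^sup>2 / 2 * (y \<bullet> y) - \<eta> * (y \<bullet> u))"
  proof -
    have Veq: "V X w = (X \<bullet> X) / 2 + P w w / 2 + X \<bullet> w" for X w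
      by (simp add: V_def P_def)
    have Pwu: "P w u = \<eta> * \<beta> * (X \<bullet> w) + \<eta> * \<alpha> * (z \<bullet> w) + 1 / \<beta> * P w e"
      using pos by (simp add: u_def Padd Pscale Pz inner_commute algebra_simps)
    have Xy: "X \<bullet> y = \<alpha> * (X \<bullet> z) + \<beta> * (X \<bullet> w) + X \<bullet> d"
      by (simp add: y_def inner_simps)
    have yw: "y \<bullet> w = \<alpha> * (z \<bullet> w) + \<beta> * (w \<bullet> w) + w \<bullet> d"
      by (simp add: y_def inner_simps inner_commute)
    have Xu: "X \<bullet> u = \<eta> * \<beta> * (X \<bullet> z) + 1 / \<beta> * (X \<bullet> e)"
      by (simp add: u_def inner_simps)
    have "V ?X' ?w' = (X \<bullet> X) / 2 - \<eta> * (X \<bullet> y) + \<eta>\<^sup>2 / 2 * (y \<bullet> y) + P w w / 2 + P w u + P u u / 2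
        + X \<bullet> w + X \<bullet> u - \<eta> * (y \<bullet> w) - \<eta> * (y \<bullet> u)"
      unfolding X' w' Veq
      by (simp add: Padd Padd' Pc[of u w] inner_simps inner_commute power2_eq_square field_simps)
    then show ?thesis
      unfolding Pwu Xy yw Xu Veq by (simp add: algebra_simps)
  qed
  define c where "c = 1 / r + \<alpha> / \<beta>"
  define XX ww dd ee where "XX = X \<bullet> X" and "ww = w \<bullet> w" and "dd = d \<bullet> d" and "ee = e \<bullet> e"
  have b1: "- (\<eta> * (\<alpha> - \<beta>) * (X \<bullet> z)) \<le> - (\<eta> * (\<alpha> - \<beta>) * r * XX)"
    using X(2) pos by (simp add: XX_def mult.assoc mult_left_mono)
  \<comment> \<open>The weights in \<open>b2\<close> to \<open>b5\<close> keep each cost in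
    \<open>XX\<close> and \<open>ww\<close> of order \<eta>. \<open>b2\<close> and \<open>b4\<close>
    together account for the 1 subtracted from \<open>(\<alpha> - \<beta>) * r\<close>;
    \<open>b3\<close> and \<open>b5\<close> give the terms subtracted from \<beta>. In
    \<open>b4\<close> and \<open>b5\<close> this puts 1/\<eta> on \<open>ee\<close>.\<close>
  have b2: "- (\<eta> * (X \<bullet> d)) \<le> \<eta> / 2 * XX + \<eta> / 2 * dd"
    using mult_left_mono[OF inner_young[of 1 X 1 d], of "\<eta> / 2"] pos by (simp add: XX_def dd_def algebra_simps)
  have b3: "- (\<eta> * (w \<bullet> d)) \<le> \<eta> / 2 * ww + \<eta> / 2 * dd"
    using mult_left_mono[OF inner_young[of 1 w 1 d], of "\<eta> / 2"] pos by (simp add: ww_def dd_def algebra_simps)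
  have b4: "1 / \<beta> * (X \<bullet> e) \<le> \<eta> / 2 * XX + 1 / (2 * \<eta> * \<beta>\<^sup>2) * ee"
    using mult_left_mono[OF inner_young[of "\<eta> * \<beta>" X "- 1" e], of "1 / (2 * \<eta> * \<beta>\<^sup>2)"] pos
    by (simp add: XX_def ee_def power2_eq_square field_simps)
  have b5: "1 / \<beta> * P w e \<le> \<eta> / (2 * \<beta>) * (c * ww) + 1 / (2 * \<eta> * \<beta>) * (c * ee)"
  proof -
    have "1 / \<beta> * P w e \<le> \<eta> / (2 * \<beta>) * P w w + 1 / (2 * \<eta> * \<beta>) * P e e"
      using mult_left_mono[OF Py[of "\<eta>" w "- 1" e], of "1 / (2 * \<eta> * \<beta>)"] pos
      by (simp add: field_simps)
    also have "\<dots> \<le> \<eta> / (2 * \<beta>) * (c * ww) + 1 / (2 * \<eta> * \<beta>) * (c * ee)"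
      using Ple pos unfolding c_def ww_def ee_def by (intro add_mono mult_left_mono) auto
    finally show ?thesis .
  qed
  have b6: "1/2 * P u u \<le> \<eta>\<^sup>2 * \<beta>\<^sup>2 * R * XX + \<eta>\<^sup>2 * (\<alpha> * \<beta>) * (z \<bullet> z) + 1 / \<beta>\<^sup>2 * (c * ee)"
  proof -
    have "P u u = (\<eta> * \<beta>) * (\<eta> * \<beta>) * P z z + 2 * (\<eta> * \<beta>) * (1 / \<beta>) * P z e + (1 / \<beta>) * (1 / \<beta>) * P e e"
      unfolding u_def by (simp add: Padd Padd' Pscale Pscale' Pc[of e z] algebra_simps)
    moreover have "0 \<le> (\<eta> * \<beta>) * (\<eta> * \<beta>) * P z z + 2 * (\<eta> * \<beta>) * (- 1 / \<beta>) * P z e + (- 1 / \<beta>) * (- 1 / \<beta>) * P e e"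
      by (rule Py)
    ultimately have "1/2 * P u u \<le> \<eta>\<^sup>2 * \<beta>\<^sup>2 * P z z + 1 / \<beta>\<^sup>2 * P e e"
      using pos by (simp add: power2_eq_square mult_ac)
    also have "\<eta>\<^sup>2 * \<beta>\<^sup>2 * P z z = \<eta>\<^sup>2 * \<beta>\<^sup>2 * (X \<bullet> z) + \<eta>\<^sup>2 * (\<alpha> * \<beta>) * (z \<bullet> z)"
      using pos by (simp add: Pz inner_commute power2_eq_square algebra_simps)
    also have "\<eta>\<^sup>2 * \<beta>\<^sup>2 * (X \<bullet> z) \<le> \<eta>\<^sup>2 * \<beta>\<^sup>2 * (R * XX)"
      using X(3) unfolding XX_def by (rule mult_left_mono) simp
    also have "1 / \<beta>\<^sup>2 * P e e \<le> 1 / \<beta>\<^sup>2 * (c * ee)"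
      using Ple[of e] unfolding c_def ee_def by (rule mult_left_mono) simp
    finally show ?thesis by (simp add: mult.assoc)
  qed
  have b7: "\<eta>\<^sup>2 / 2 * (y \<bullet> y) - \<eta> * (y \<bullet> u)
    \<le> \<eta>\<^sup>2 * (2 * \<alpha>\<^sup>2 + \<beta>\<^sup>2 - \<alpha> * \<beta>) * (z \<bullet> z) + \<eta>\<^sup>2 * (2 * \<beta>\<^sup>2 + 1/2) * ww
      + 5/2 * \<eta>\<^sup>2 * dd + (1/2 + 1 / \<beta>\<^sup>2) * ee"
    unfolding y_def u_def ww_def dd_def ee_def using pos(1) by (rule cross_term_bound)
  have b8: "\<eta>\<^sup>2 * (2 * \<alpha>\<^sup>2 + \<beta>\<^sup>2) * (z \<bullet> z) \<le> \<eta>\<^sup>2 * (2 * \<alpha>\<^sup>2 + \<beta>\<^sup>2) * (R\<^sup>2 * XX)"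
    using X(4) unfolding XX_def by (rule mult_left_mono) simp
  \<comment> \<open>The negative \<open>\<alpha> * \<beta>\<close> kept in
    \<open>cross_term_bound\<close> cancels the one produced by \<open>P z z\<close> in
    \<open>b6\<close>.\<close>
  have split_zz: "\<eta>\<^sup>2 * (2 * \<alpha>\<^sup>2 + \<beta>\<^sup>2 - \<alpha> * \<beta>) * (z \<bullet> z) + \<eta>\<^sup>2 * (\<alpha> * \<beta>) * (z \<bullet> z) = \<eta>\<^sup>2 * (2 * \<alpha>\<^sup>2 + \<beta>\<^sup>2) * (z \<bullet> z)"
    by (simp add: algebra_simps)
  have "V ?X' ?w' \<le> V X w - \<eta> * (\<alpha> - \<beta>) * r * XX - \<eta> * \<beta> * ww + (\<eta> / 2 * XX + \<eta> / 2 * dd)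
      + (\<eta> / 2 * ww + \<eta> / 2 * dd) + (\<eta> / 2 * XX + 1 / (2 * \<eta> * \<beta>\<^sup>2) * ee)
      + (\<eta> / (2 * \<beta>) * (c * ww) + 1 / (2 * \<eta> * \<beta>) * (c * ee))
      + (\<eta>\<^sup>2 * \<beta>\<^sup>2 * R * XX + 1 / \<beta>\<^sup>2 * (c * ee)) + \<eta>\<^sup>2 * (2 * \<alpha>\<^sup>2 + \<beta>\<^sup>2) * (R\<^sup>2 * XX)
      + \<eta>\<^sup>2 * (2 * \<beta>\<^sup>2 + 1/2) * ww + 5/2 * \<eta>\<^sup>2 * dd + (1/2 + 1 / \<beta>\<^sup>2) * ee"
    using expand b1 b2 b3 b4 b5 b6 b7 b8 split_zz unfolding ww_def[symmetric] by linarith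
  also have "\<dots> = ?rhs"
  proof -
    have "\<eta> / (2 * \<beta>) * (c * ww) = \<eta> * (\<alpha> / (2 * \<beta>\<^sup>2) + 1 / (2 * \<beta> * r)) * ww"
      using pos by (simp add: c_def power2_eq_square field_simps)
    then show ?thesis
      unfolding XX_def[symmetric] ww_def[symmetric] dd_def[symmetric] ee_def[symmetric] c_def[symmetric]
      by (simp add: algebra_simps power2_eq_square)
  qed
  finally show ?thesis .
qed

lemma primal_dual_lyapunov_lower:
  fixes X w :: "'a::real_inner"
  assumes "0 \<le> w \<bullet> Q w" "0 < \<beta>" "\<beta> < \<alpha>"
  shows "0 \<le> (X \<bullet> X) / 2 + (w \<bullet> Q w + \<alpha> / \<beta> * (w \<bullet> w)) / 2 + X \<bullet> w"
proof -
  define t where "t = \<alpha> / \<beta> * (w \<bullet> w)"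
  have "1 * (w \<bullet> w) \<le> t"
    unfolding t_def using assms by (intro mult_right_mono) auto
  then show ?thesis using inner_young[of 1 X 1 w] assms(1)
    unfolding t_def[symmetric] by (simp add: add_divide_distrib)
qed

lemma primal_dual_lyapunov_upper:
  fixes X w :: "'a::real_inner"
  assumes "w \<bullet> Q w \<le> (w \<bullet> w) / r" "0 < \<beta>" "\<beta> < \<alpha>" "0 < r"
  shows "(X \<bullet> X) / 2 + (w \<bullet> Q w + \<alpha> / \<beta> * (w \<bullet> w)) / 2 + X \<bullet> w
    \<le> ((\<alpha> + \<beta>) / (2 * \<beta>) + 1 / (2 * r)) * (X \<bullet> X + w \<bullet> w)"
proof -
  define t k where "t = \<alpha> / \<beta> * (w \<bullet> w)" and "k = (\<alpha> + \<beta>) / (2 * \<beta>) + 1 / (2 * r)"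
  have "1 \<le> k"
    using assms unfolding k_def by (intro add_increasing2) auto
  then have "1 * (X \<bullet> X) \<le> k * (X \<bullet> X)"
    by (intro mult_right_mono) auto
  \<comment> \<open>\<open>k\<close> equals 1/2 + (1/r + \<alpha>/\<beta>)/2: the first half pays
    for \<open>X \<bullet> w\<close>, the rest for the quadratic form in \<open>w\<close>.\<close>
  moreover have "k * (w \<bullet> w) = (w \<bullet> w) / 2 + ((w \<bullet> w) / r + t) / 2"
    using assms by (simp add: t_def k_def field_simps)
  moreover have "X \<bullet> w \<le> (X \<bullet> X) / 2 + (w \<bullet> w) / 2"
    using inner_young[of 1 X "- 1" w] by simp
  ultimately show ?thesis using assms(1)
    unfolding t_def[symmetric] k_def[symmetric] distrib_left by argo
qed

subsection \<open>The zeroth-order algorithm\<close>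

lemma norm_add_diff_squared_le:
  fixes a b c :: "'a::real_inner"
  shows "(norm (a + b - c))\<^sup>2 \<le> 3 * ((norm a)\<^sup>2 + (norm b)\<^sup>2 + (norm c)\<^sup>2)"
proof -
  have "3 * ((norm a)\<^sup>2 + (norm b)\<^sup>2 + (norm c)\<^sup>2) - (norm (a + b - c))\<^sup>2
      = (norm (a - b))\<^sup>2 + (norm (a + c))\<^sup>2 + (norm (b + c))\<^sup>2"
    by (simp add: power2_norm_eq_inner inner_simps inner_commute)
  moreover have "0 \<le> (norm (a - b))\<^sup>2 + (norm (a + c))\<^sup>2 + (norm (b + c))\<^sup>2" by simp
  ultimately show ?thesis by linarith
qed

lemma telescope_descent:
  fixes V S b :: "nat \<Rightarrow> real"
  assumes "\<And>k. V (Suc k) \<le> V k - c * S k + a * b k + e * b (Suc k)"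
  shows "V (Suc T) + c * (\<Sum>k\<le>T. S k) \<le> V 0 + a * (\<Sum>k\<le>T. b k) + e * (\<Sum>k\<le>T. b (Suc k))"
proof (induction T)
  case 0
  show ?case using assms[of 0] by simp
next
  case (Suc T)
  then show ?case using assms[of "Suc T"] by (simp add: distrib_left)
qed

section \<open>Averaged and centered dynamics of the algorithm\<close>

locale zeroth_order_primal_dual = connected_graph A for A :: "real^'n^'n" +
  fixes fi :: "'n \<Rightarrow> real^'p \<Rightarrow> real" and gi :: "'n \<Rightarrow> real^'p \<Rightarrow> real^'p"
    and n p Lf \<alpha> \<beta> \<eta> :: real and \<delta> :: "'n \<Rightarrow> nat \<Rightarrow> real" and x v :: "nat \<Rightarrow> 'n \<Rightarrow> real^'p"
  assumes n_def: "n = real CARD('n)" and p_def: "p = real CARD('p)"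
    and grad: "GDERIV (fi i) y :> gi i y"
    and lip: "norm (gi i y - gi i z) \<le> Lf * norm (y - z)"
    and Lf_pos: "Lf > 0" and \<beta>_pos: "\<beta> > 0" and \<beta>_less: "\<beta> < \<alpha>" and \<eta>_pos: "\<eta> > 0"
    and \<delta>_pos: "\<delta> i k > 0"
    and v0: "(\<Sum>j\<in>UNIV. v 0 j) = 0"
    and x_step: "x (Suc k) i = x k i - \<eta> *\<^sub>R
       (\<alpha> *\<^sub>R (\<Sum>j\<in>UNIV. laplacian A $ i $ j *\<^sub>R x k j) + \<beta> *\<^sub>R v k i + grad_est (fi i) (x k i) (\<delta> i k))"
    and v_step: "v (Suc k) i = v k i + (\<eta> * \<beta>) *\<^sub>R (\<Sum>j\<in>UNIV. laplacian A $ i $ j *\<^sub>R x k j)"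
begin

abbreviation "r \<equiv> rho2 (laplacian A)"
abbreviation "R \<equiv> rho (laplacian A)"
abbreviation "N \<equiv> 3 * n * p * Lf\<^sup>2 / 4"

definition "xbar k = avg (x k)"
definition "\<delta>max k = Max (range (\<lambda>i. \<delta> i k))"
definition "h k i = grad_est (fi i) (x k i) (\<delta> i k)"
definition "h0 k i = grad_est (fi i) (xbar k) (\<delta>max k)"
definition "X k = center (\<chi> i. x k i)"
definition "W k = center (\<chi> i. v k i + (1 / \<beta>) *\<^sub>R h0 k i)"
definition "D k = center (\<chi> i. h k i - h0 k i)"
definition "E k = center (\<chi> i. h0 (Suc k) i - h0 k i)"

lemma \<delta>_le_max: "\<delta> i k \<le> \<delta>max k"
  unfolding \<delta>max_def by (rule Max_ge) auto

lemma \<delta>max_pos: "\<delta>max k > 0"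
  using \<delta>_pos \<delta>_le_max order_less_le_trans by blast

lemma \<delta>max_squared_le: "(\<delta>max k)\<^sup>2 \<le> (\<Sum>i\<in>UNIV. (\<delta> i k)\<^sup>2)"
proof -
  have "\<delta>max k \<in> range (\<lambda>i. \<delta> i k)"
    unfolding \<delta>max_def by (rule Max_in) auto
  then obtain i where "\<delta>max k = \<delta> i k" by blast
  then show ?thesis by (simp add: member_le_sum[of i UNIV "\<lambda>i. (\<delta> i k)\<^sup>2"])
qed

lemma x_step_Lap: "(\<chi> i. x (Suc k) i) = (\<chi> i. x k i) - \<eta> *\<^sub>R (\<alpha> *\<^sub>R Lap (\<chi> i. x k i) + \<beta> *\<^sub>R (\<chi> i. v k i) + (\<chi> i. h k i))"
  by (simp add: vec_eq_iff x_step h_def block_mult_def)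

lemma v_step_Lap: "(\<chi> i. v (Suc k) i) = (\<chi> i. v k i) + (\<eta> * \<beta>) *\<^sub>R Lap (\<chi> i. x k i)"
  by (simp add: vec_eq_iff v_step block_mult_def)

lemma avg_v: "avg (v k) = 0"
proof (induction k)
  case 0
  show ?case using v0 by (simp add: avg_def)
next
  case (Suc k)
  have "avg (v (Suc k)) = avg (($) (\<chi> i. v (Suc k) i))"
    by (simp add: vec_lambda_inverse)
  also have "\<dots> = 0"
    unfolding v_step_Lap avg_nth_add avg_nth_scaleR avg_Lap using Suc by (simp add: vec_lambda_inverse)
  finally show ?case .
qed

text \<open>Both the Laplacian term and the dual variables have zero mean, so the average follows a
  plain descent step along the averaged estimates.\<close>

lemma xbar_step: "xbar (Suc k) = xbar k - \<eta> *\<^sub>R avg (h k)"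
proof -
  have "xbar (Suc k) + \<eta> *\<^sub>R avg (h k) = avg (($) ((\<chi> i. x (Suc k) i) + \<eta> *\<^sub>R (\<chi> i. h k i)))"
    by (simp only: avg_nth_add avg_nth_scaleR) (simp add: xbar_def vec_lambda_inverse)
  also have "(\<chi> i. x (Suc k) i) + \<eta> *\<^sub>R (\<chi> i. h k i)
      = (\<chi> i. x k i) + (- \<eta> * \<alpha>) *\<^sub>R Lap (\<chi> i. x k i) + (- \<eta> * \<beta>) *\<^sub>R (\<chi> i. v k i)"
    unfolding x_step_Lap by (simp add: algebra_simps)
  also have "avg (($) \<dots>) = xbar k"
    unfolding avg_nth_add avg_nth_scaleR avg_Lap by (simp add: vec_lambda_inverse xbar_def avg_v)
  finally show ?thesis by (simp add: algebra_simps)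
qed

lemma Lap_X: "Lap (X k) = Lap (\<chi> i. x k i)"
  by (simp add: X_def block_mult_laplacian_center)

lemma X_step: "X (Suc k) = X k - \<eta> *\<^sub>R (\<alpha> *\<^sub>R Lap (X k) + \<beta> *\<^sub>R W k + D k)"
proof -
  \<comment> \<open>Adding and subtracting \<open>h0\<close> splits the dual term plus estimate into
    \<open>\<beta>\<close> times the shifted dual variable and the perturbation
    \<open>h - h0\<close>.\<close>
  have "(\<chi> i. x (Suc k) i) = (\<chi> i. x k i) - \<eta> *\<^sub>R (\<alpha> *\<^sub>R Lap (\<chi> i. x k i)
      + \<beta> *\<^sub>R (\<chi> i. v k i + (1 / \<beta>) *\<^sub>R h0 k i) + (\<chi> i. h k i - h0 k i))"
    using \<beta>_pos unfolding x_step_Lap by (simp add: vec_eq_iff algebra_simps)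
  then show ?thesis
    unfolding Lap_X by (simp add: X_def W_def D_def linear_center linear_add linear_diff linear_scale center_Lap)
qed

lemma W_step: "W (Suc k) = W k + (\<eta> * \<beta>) *\<^sub>R Lap (X k) + (1 / \<beta>) *\<^sub>R E k"
proof -
  have "(\<chi> i. v (Suc k) i + (1 / \<beta>) *\<^sub>R h0 (Suc k) i) = (\<chi> i. v k i + (1 / \<beta>) *\<^sub>R h0 k i)
     + (\<eta> * \<beta>) *\<^sub>R Lap (\<chi> i. x k i) + (1 / \<beta>) *\<^sub>R (\<chi> i. h0 (Suc k) i - h0 k i)"
    by (simp add: vec_eq_iff v_step block_mult_def algebra_simps)
  then show ?thesis
    unfolding Lap_X by (simp add: W_def E_def linear_center linear_add linear_diff linear_scale center_Lap)
qed

lemma X_norm: "X k \<bullet> X k = (\<Sum>i\<in>UNIV. (norm (x k i - xbar k))\<^sup>2)"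
  unfolding X_def knorm2_eq[symmetric] knorm2_def xbar_def ..

lemma h_error: "(norm (h k i - gi i (x k i)))\<^sup>2 \<le> p * Lf\<^sup>2 / 4 * (\<delta>max k)\<^sup>2"
proof -
  have "(norm (h k i - gi i (x k i)))\<^sup>2 \<le> p * Lf\<^sup>2 * (\<delta> i k)\<^sup>2 / 4"
    unfolding h_def p_def using grad lip \<delta>_pos by (rule grad_est_error)
  also have "\<dots> \<le> p * Lf\<^sup>2 * (\<delta>max k)\<^sup>2 / 4"
    using \<delta>_le_max[of i k] \<delta>_pos[of i k]
    by (intro divide_right_mono mult_left_mono power_mono) (auto simp: p_def)
  finally show ?thesis by simp
qed

lemma h0_error: "(norm (h0 k i - gi i (xbar k)))\<^sup>2 \<le> p * Lf\<^sup>2 / 4 * (\<delta>max k)\<^sup>2"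
  using grad_est_error[OF grad lip \<delta>max_pos] by (simp add: h0_def p_def)

lemma lip_squared: "(norm (gi i y - gi i z))\<^sup>2 \<le> Lf\<^sup>2 * (norm (y - z))\<^sup>2"
  using power_mono[OF lip norm_ge_zero, of i y z 2] by (simp add: power_mult_distrib)

lemma D_norm: "D k \<bullet> D k \<le> 3 * Lf\<^sup>2 * (X k \<bullet> X k) + 2 * N * (\<delta>max k)\<^sup>2"
proof -
  define q where "q = p * Lf\<^sup>2 / 4"
  have "D k \<bullet> D k \<le> (\<Sum>i\<in>UNIV. (norm (h k i - h0 k i))\<^sup>2)"
    unfolding D_def knorm2_eq[symmetric] by (rule knorm2_le)
  also have "\<dots> \<le> (\<Sum>i\<in>(UNIV::'n set). 3 * (Lf\<^sup>2 * (norm (x k i - xbar k))\<^sup>2) + 6 * (q * (\<delta>max k)\<^sup>2))"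
  proof (rule sum_mono)
    fix i
    have "h k i - h0 k i = (h k i - gi i (x k i)) + (gi i (x k i) - gi i (xbar k)) - (h0 k i - gi i (xbar k))"
      by simp
    then have "(norm (h k i - h0 k i))\<^sup>2 \<le> 3 * ((norm (h k i - gi i (x k i)))\<^sup>2
        + (norm (gi i (x k i) - gi i (xbar k)))\<^sup>2 + (norm (h0 k i - gi i (xbar k)))\<^sup>2)"
      by (metis norm_add_diff_squared_le)
    also have "\<dots> \<le> 3 * (q * (\<delta>max k)\<^sup>2 + Lf\<^sup>2 * (norm (x k i - xbar k))\<^sup>2 + q * (\<delta>max k)\<^sup>2)"
      using h_error h0_error unfolding q_def by (intro mult_left_mono add_mono lip_squared) auto
    finally show "(norm (h k i - h0 k i))\<^sup>2 \<le> 3 * (Lf\<^sup>2 * (norm (x k i - xbar k))\<^sup>2) + 6 * (q * (\<delta>max k)\<^sup>2)"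
      by (simp add: algebra_simps)
  qed
  also have "\<dots> = 3 * Lf\<^sup>2 * (X k \<bullet> X k) + 2 * N * (\<delta>max k)\<^sup>2"
    by (simp add: X_norm n_def q_def sum.distrib sum_distrib_left mult.assoc)
  finally show ?thesis .
qed

text \<open>The reference gradients move only with the average and the radius. By
  \<open>xbar_step\<close> the displacement is \<open>\<eta> *\<^sub>R avg (h k)\<close>, which
  supplies the factor \<open>\<eta>\<^sup>2\<close>; both radii appear because two successive
  estimates are compared.\<close>

lemma E_norm: "E k \<bullet> E k \<le> 3 * Lf\<^sup>2 * \<eta>\<^sup>2 * (n * (norm (avg (h k)))\<^sup>2) + N * ((\<delta>max k)\<^sup>2 + (\<delta>max (Suc k))\<^sup>2)"
proof -
  define q where "q = p * Lf\<^sup>2 / 4"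
  have "E k \<bullet> E k \<le> (\<Sum>i\<in>UNIV. (norm (h0 (Suc k) i - h0 k i))\<^sup>2)"
    unfolding E_def knorm2_eq[symmetric] by (rule knorm2_le)
  also have "\<dots> \<le> (\<Sum>i\<in>(UNIV::'n set). 3 * (Lf\<^sup>2 * (norm (xbar (Suc k) - xbar k))\<^sup>2) + 3 * (q * (\<delta>max k)\<^sup>2) + 3 * (q * (\<delta>max (Suc k))\<^sup>2))"
  proof (rule sum_mono)
    fix i
    have "h0 (Suc k) i - h0 k i = (h0 (Suc k) i - gi i (xbar (Suc k))) + (gi i (xbar (Suc k)) - gi i (xbar k)) - (h0 k i - gi i (xbar k))"
      by simp
    then have "(norm (h0 (Suc k) i - h0 k i))\<^sup>2 \<le> 3 * ((norm (h0 (Suc k) i - gi i (xbar (Suc k))))\<^sup>2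
        + (norm (gi i (xbar (Suc k)) - gi i (xbar k)))\<^sup>2 + (norm (h0 k i - gi i (xbar k)))\<^sup>2)"
      by (metis norm_add_diff_squared_le)
    with h0_error[of "Suc k" i, folded q_def] h0_error[of k i, folded q_def] lip_squared[of i "xbar (Suc k)" "xbar k"]
    show "(norm (h0 (Suc k) i - h0 k i))\<^sup>2 \<le> 3 * (Lf\<^sup>2 * (norm (xbar (Suc k) - xbar k))\<^sup>2) + 3 * (q * (\<delta>max k)\<^sup>2) + 3 * (q * (\<delta>max (Suc k))\<^sup>2)"
      by argo
  qed
  also have "\<dots> = 3 * Lf\<^sup>2 * \<eta>\<^sup>2 * (n * (norm (avg (h k)))\<^sup>2) + N * ((\<delta>max k)\<^sup>2 + (\<delta>max (Suc k))\<^sup>2)"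
    by (simp add: xbar_step q_def n_def power_mult_distrib algebra_simps)
  finally show ?thesis .
qed

lemma avg_gradient_error:
  "n * (norm (avg (h k) - gavg gi (xbar k)))\<^sup>2 \<le> 3 * Lf\<^sup>2 * (X k \<bullet> X k) + N * (\<delta>max k)\<^sup>2"
proof -
  define q where "q = p * Lf\<^sup>2 / 4"
  have "avg (h k) - gavg gi (xbar k) = avg (\<lambda>i. h k i - gi i (xbar k))"
    by (simp add: avg_diff) (simp add: avg_def gavg_def)
  then have "n * (norm (avg (h k) - gavg gi (xbar k)))\<^sup>2 \<le> (\<Sum>i\<in>UNIV. (norm (h k i - gi i (xbar k)))\<^sup>2)"
    by (simp add: card_norm_avg_le n_def)
  also have "\<dots> \<le> (\<Sum>i\<in>(UNIV::'n set). 3 * (Lf\<^sup>2 * (norm (x k i - xbar k))\<^sup>2) + 3 * (q * (\<delta>max k)\<^sup>2))"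
  proof (rule sum_mono)
    fix i
    \<comment> \<open>Padding with 0 reuses the three-term inequality. Only one estimation error
      occurs, hence \<open>N\<close> where \<open>D_norm\<close> has \<open>2 * N\<close>.\<close>
    have "h k i - gi i (xbar k) = (h k i - gi i (x k i)) + (gi i (x k i) - gi i (xbar k)) - 0" by simp
    then have "(norm (h k i - gi i (xbar k)))\<^sup>2 \<le> 3 * ((norm (h k i - gi i (x k i)))\<^sup>2
        + (norm (gi i (x k i) - gi i (xbar k)))\<^sup>2 + (norm (0 :: real^'p))\<^sup>2)"
      by (metis norm_add_diff_squared_le)
    with h_error[of k i, folded q_def] lip_squared[of i "x k i" "xbar k"]
    show "(norm (h k i - gi i (xbar k)))\<^sup>2 \<le> 3 * (Lf\<^sup>2 * (norm (x k i - xbar k))\<^sup>2) + 3 * (q * (\<delta>max k)\<^sup>2)"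
      by simp
  qed
  also have "\<dots> = 3 * Lf\<^sup>2 * (X k \<bullet> X k) + N * (\<delta>max k)\<^sup>2"
    by (simp add: X_norm n_def q_def sum.distrib sum_distrib_left mult.assoc)
  finally show ?thesis .
qed

lemma objective_step:
  "n * favg fi (xbar (Suc k)) \<le> n * favg fi (xbar k) - \<eta> / 2 * (n * (norm (avg (h k)))\<^sup>2)
    - \<eta> / 2 * (n * (norm (gavg gi (xbar k)))\<^sup>2) + \<eta> / 2 * (n * (norm (avg (h k) - gavg gi (xbar k)))\<^sup>2)
    + Lf / 2 * \<eta>\<^sup>2 * (n * (norm (avg (h k)))\<^sup>2)"
proof -
  define u where "u = avg (h k)"
  define g where "g = gavg gi (xbar k)"
  have "(\<Sum>i\<in>UNIV. fi i (xbar (Suc k))) \<le> (\<Sum>i\<in>UNIV. fi i (xbar k) + gi i (xbar k) \<bullet> (- \<eta> *\<^sub>R u) + Lf / 2 * (norm (- \<eta> *\<^sub>R u))\<^sup>2)"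
  proof (rule sum_mono)
    fix i
    show "fi i (xbar (Suc k)) \<le> fi i (xbar k) + gi i (xbar k) \<bullet> (- \<eta> *\<^sub>R u) + Lf / 2 * (norm (- \<eta> *\<^sub>R u))\<^sup>2"
      using gradient_lipschitz_upper[OF grad lip, of i "xbar k" "- \<eta> *\<^sub>R u"] by (simp add: xbar_step u_def)
  qed
  also have "\<dots> = (\<Sum>i\<in>UNIV. fi i (xbar k)) - \<eta> * ((\<Sum>i\<in>UNIV. gi i (xbar k)) \<bullet> u) + Lf / 2 * \<eta>\<^sup>2 * (n * (norm u)\<^sup>2)"
    by (simp add: sum.distrib sum_subtractf sum_negf inner_sum_left sum_distrib_left power_mult_distrib n_def)
  also have "(\<Sum>i\<in>UNIV. gi i (xbar k)) = n *\<^sub>R g"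
    by (simp add: g_def gavg_def n_def)
  \<comment> \<open>Polarization instead of Cauchy-Schwarz: it yields dissipation both in the
    average estimate and in the true average gradient.\<close>
  also have "n *\<^sub>R g \<bullet> u = n * ((norm u)\<^sup>2 + (norm g)\<^sup>2 - (norm (u - g))\<^sup>2) / 2"
    by (simp add: power2_norm_eq_inner inner_simps inner_commute)
  finally show ?thesis
    unfolding u_def[symmetric] g_def[symmetric]
    by (simp add: favg_def n_def field_simps)
qed

lemma lyapunov_function:
  assumes lower: "\<And>y. fstar \<le> favg fi y"
    and \<eta>w: "\<eta> * (2 * \<beta>\<^sup>2 + 1/2) \<le> \<beta> - 1/2 - \<alpha> / (2 * \<beta>\<^sup>2) - 1 / (2 * \<beta> * r)"
    and \<eta>h: "\<eta> * (3 / \<beta>\<^sup>2 * (1 + 1 / r + \<alpha> / \<beta>) * Lf\<^sup>2 + Lf * (1 + 3 * Lf) / 2)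
        \<le> 1/2 - 3 / (2 * \<beta>) * (1 / \<beta> + 1 / r + \<alpha> / \<beta>) * Lf\<^sup>2"
  defines "\<epsilon>12 \<equiv> ((1 / \<beta>\<^sup>2 + 1 / (2 * \<eta> * \<beta>)) * (1 / r + \<alpha> / \<beta>) + 1 / (2 * \<eta> * \<beta>\<^sup>2) + 1 / \<beta>\<^sup>2 + 1/2) * N"
  obtains V where "\<And>k. n * (favg fi (xbar k) - fstar) \<le> V k"
    "V 0 \<le> ((\<alpha> + \<beta>) / (2 * \<beta>) + 1 / (2 * r))
       * (knorm2 (x 0) + knorm2 (\<lambda>i. v 0 i + (1 / \<beta>) *\<^sub>R h0 0 i) + n * (favg fi (xbar 0) - fstar))"
    "\<And>k. V (Suc k) \<le> V k
      - \<eta> * ((\<alpha> - \<beta>) * r - (2 + 9 * Lf\<^sup>2) / 2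
          - \<eta> * (\<beta>\<^sup>2 * R + (2 * \<alpha>\<^sup>2 + \<beta>\<^sup>2) * R\<^sup>2 + 15 / 2 * Lf\<^sup>2)) * (X k \<bullet> X k)
      - \<eta> / 2 * (n * (norm (gavg gi (xbar k)))\<^sup>2)
      + ((15 * \<eta> / 4 + 5 * \<eta>\<^sup>2) * N + \<epsilon>12) * (\<delta>max k)\<^sup>2 + \<epsilon>12 * (\<delta>max (Suc k))\<^sup>2"
proof -
  obtain Q :: "real^'p^'n \<Rightarrow> real^'p^'n"
    where Q: "linear Q" "\<And>Z. Q (Lap Z) = center Z" "\<And>x y. x \<bullet> Q y = Q x \<bullet> y"
      "\<And>x. 0 \<le> x \<bullet> Q x" "\<And>x. x \<bullet> Q x \<le> (x \<bullet> x) / r"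
    using Lap_inverse by blast
  define U where "U X w = (X \<bullet> X) / 2 + (w \<bullet> Q w + \<alpha> / \<beta> * (w \<bullet> w)) / 2 + X \<bullet> w" for X w
  define V where "V k = U (X k) (W k) + n * (favg fi (xbar k) - fstar)" for k
  have "n * (favg fi (xbar k) - fstar) \<le> V k" for k
    using primal_dual_lyapunov_lower[where Q = Q and X = "X k" and w = "W k", OF Q(4) \<beta>_pos \<beta>_less]
    by (simp add: V_def U_def)
  moreover have "V 0 \<le> ((\<alpha> + \<beta>) / (2 * \<beta>) + 1 / (2 * r))
       * (knorm2 (x 0) + knorm2 (\<lambda>i. v 0 i + (1 / \<beta>) *\<^sub>R h0 0 i) + n * (favg fi (xbar 0) - fstar))"
  proof -
    \<comment> \<open>The nonnegative objective gap has coefficient 1 in \<open>V\<close>, so it too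
      fits under the common factor.\<close>
    have "1 \<le> (\<alpha> + \<beta>) / (2 * \<beta>) + 1 / (2 * r)"
      using \<beta>_pos \<beta>_less rho2_pos by (intro add_increasing2) auto
    then have "1 * (n * (favg fi (xbar 0) - fstar)) \<le> ((\<alpha> + \<beta>) / (2 * \<beta>) + 1 / (2 * r)) * (n * (favg fi (xbar 0) - fstar))"
      using lower[of "xbar 0"] by (intro mult_right_mono) (auto simp: n_def)
    moreover have "U (X 0) (W 0) \<le> ((\<alpha> + \<beta>) / (2 * \<beta>) + 1 / (2 * r)) * (X 0 \<bullet> X 0 + W 0 \<bullet> W 0)"
      unfolding U_def using Q(5) \<beta>_pos \<beta>_less rho2_pos by (rule primal_dual_lyapunov_upper)
    moreover have "X 0 \<bullet> X 0 = knorm2 (x 0)" "W 0 \<bullet> W 0 = knorm2 (\<lambda>i. v 0 i + (1 / \<beta>) *\<^sub>R h0 0 i)"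
      by (simp_all add: X_def W_def knorm2_eq)
    ultimately show ?thesis
      unfolding V_def distrib_left[of _ "knorm2 (x 0) + knorm2 (\<lambda>i. v 0 i + (1 / \<beta>) *\<^sub>R h0 0 i)"] by simp
  qed
  moreover have "V (Suc k) \<le> V k
      - \<eta> * ((\<alpha> - \<beta>) * r - (2 + 9 * Lf\<^sup>2) / 2
          - \<eta> * (\<beta>\<^sup>2 * R + (2 * \<alpha>\<^sup>2 + \<beta>\<^sup>2) * R\<^sup>2 + 15 / 2 * Lf\<^sup>2)) * (X k \<bullet> X k)
      - \<eta> / 2 * (n * (norm (gavg gi (xbar k)))\<^sup>2)
      + ((15 * \<eta> / 4 + 5 * \<eta>\<^sup>2) * N + \<epsilon>12) * (\<delta>max k)\<^sup>2 + \<epsilon>12 * (\<delta>max (Suc k))\<^sup>2" for k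
  proof -
    define XX where "XX = X k \<bullet> X k"
    define H where "H = n * (norm (avg (h k)))\<^sup>2"
    define G where "G = n * (norm (gavg gi (xbar k)))\<^sup>2"
    define a b where "a = (\<delta>max k)\<^sup>2" and "b = (\<delta>max (Suc k))\<^sup>2"
    define C where "C = (1 / \<beta>\<^sup>2 + 1 / (2 * \<eta> * \<beta>)) * (1 / r + \<alpha> / \<beta>) + 1 / (2 * \<eta> * \<beta>\<^sup>2) + 1 / \<beta>\<^sup>2 + 1/2"
    define K where "K = (\<alpha> - \<beta>) * r - 1 - \<eta> * (\<beta>\<^sup>2 * R + (2 * \<alpha>\<^sup>2 + \<beta>\<^sup>2) * R\<^sup>2)"
    have centered: "center (X k) = X k" by (simp add: X_def center_eq_self avg_center)
    have X: "Q (Lap (X k)) = X k" "r * (X k \<bullet> X k) \<le> X k \<bullet> Lap (X k)"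
      using rho2_le_inner_Lap[of "X k"] by (simp_all add: Q centered)
    have \<epsilon>12: "\<epsilon>12 = C * N" by (simp add: \<epsilon>12_def C_def)
    have C: "C \<ge> 0"
      unfolding C_def using \<beta>_pos \<beta>_less \<eta>_pos rho2_pos
      by (intro add_nonneg_nonneg mult_nonneg_nonneg) auto
    have "U (X (Suc k)) (W (Suc k)) \<le> U (X k) (W k) - \<eta> * K * XX
      - \<eta> * (\<beta> - 1/2 - \<alpha> / (2 * \<beta>\<^sup>2) - 1 / (2 * \<beta> * r) - \<eta> * (2 * \<beta>\<^sup>2 + 1/2)) * (W k \<bullet> W k)
      + (\<eta> + 5/2 * \<eta>\<^sup>2) * (D k \<bullet> D k) + C * (E k \<bullet> E k)"
      unfolding U_def X_step W_step K_def C_def XX_def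
      by (rule primal_dual_step[OF Q(1,3-5) X inner_Lap_le_rho Lap_norm_le \<beta>_pos \<beta>_less \<eta>_pos rho2_pos])
    moreover have "0 \<le> \<eta> * (\<beta> - 1/2 - \<alpha> / (2 * \<beta>\<^sup>2) - 1 / (2 * \<beta> * r) - \<eta> * (2 * \<beta>\<^sup>2 + 1/2)) * (W k \<bullet> W k)"
      using \<eta>w \<eta>_pos by (intro mult_nonneg_nonneg) auto
    moreover have "(\<eta> + 5/2 * \<eta>\<^sup>2) * (D k \<bullet> D k) \<le> (\<eta> + 5/2 * \<eta>\<^sup>2) * (3 * Lf\<^sup>2 * XX + 2 * N * a)"
      using D_norm[of k] \<eta>_pos unfolding XX_def a_def by (intro mult_left_mono) auto
    moreover have "C * (E k \<bullet> E k) \<le> C * (3 * Lf\<^sup>2 * \<eta>\<^sup>2 * H + N * (a + b))"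
      using E_norm[of k] C unfolding H_def a_def b_def by (rule mult_left_mono)
    moreover have "n * favg fi (xbar (Suc k)) \<le> n * favg fi (xbar k) - \<eta> / 2 * H - \<eta> / 2 * G
        + \<eta> / 2 * (3 * Lf\<^sup>2 * XX + N * a) + Lf / 2 * \<eta>\<^sup>2 * H"
    proof -
      have "\<eta> / 2 * (n * (norm (avg (h k) - gavg gi (xbar k)))\<^sup>2) \<le> \<eta> / 2 * (3 * Lf\<^sup>2 * XX + N * a)"
        using avg_gradient_error[of k] \<eta>_pos unfolding XX_def a_def by (intro mult_left_mono) auto
      with objective_step[of k] show ?thesis unfolding H_def G_def by linarith
    qed
    moreover have "(3 * Lf\<^sup>2 * \<eta>\<^sup>2 * C + Lf / 2 * \<eta>\<^sup>2 - \<eta> / 2) * H \<le> 0"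
    proof -
      \<comment> \<open>\<open>C\<close> contains terms in 1/\<eta>. These give the part of order
        \<eta> subtracted from 1/2; everything else is of order
        \<open>\<eta>\<^sup>2\<close>.\<close>
      have "3 * Lf\<^sup>2 * \<eta>\<^sup>2 * C + Lf / 2 * \<eta>\<^sup>2 - \<eta> / 2
        = \<eta> * (\<eta> * (3 / \<beta>\<^sup>2 * (1 + 1 / r + \<alpha> / \<beta>) * Lf\<^sup>2 + Lf * (1 + 3 * Lf) / 2)
            - (1/2 - 3 / (2 * \<beta>) * (1 / \<beta> + 1 / r + \<alpha> / \<beta>) * Lf\<^sup>2))"
        using \<beta>_pos \<eta>_pos rho2_pos by (simp add: C_def power2_eq_square field_simps)
      also have "\<dots> \<le> 0"
        using \<eta>h \<eta>_pos by (intro mult_nonneg_nonpos) auto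
      finally show ?thesis
        by (intro mult_nonpos_nonneg) (auto simp: H_def n_def)
    qed
    \<comment> \<open>The estimates give \<open>5/2 * \<eta> * N * a\<close> at first order in
      \<eta>, apart from the \<open>C\<close> term; this rounds it up to
      \<open>15/4 * \<eta> * N * a\<close>.\<close>
    moreover have "0 \<le> 5/4 * \<eta> * N * a"
      using \<eta>_pos unfolding a_def by (intro mult_nonneg_nonneg) (auto simp: n_def p_def)
    ultimately have "V (Suc k) \<le> V k - \<eta> * K * XX + (\<eta> + 5/2 * \<eta>\<^sup>2) * (3 * Lf\<^sup>2 * XX + 2 * N * a)
        + C * N * (a + b) - \<eta> / 2 * G + \<eta> / 2 * (3 * Lf\<^sup>2 * XX + N * a) + 5/4 * \<eta> * N * a"
      unfolding V_def by (simp add: algebra_simps)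
    also have "\<dots> = V k
      - \<eta> * ((\<alpha> - \<beta>) * r - (2 + 9 * Lf\<^sup>2) / 2
          - \<eta> * (\<beta>\<^sup>2 * R + (2 * \<alpha>\<^sup>2 + \<beta>\<^sup>2) * R\<^sup>2 + 15 / 2 * Lf\<^sup>2)) * XX
      - \<eta> / 2 * G + ((15 * \<eta> / 4 + 5 * \<eta>\<^sup>2) * N + \<epsilon>12) * a + \<epsilon>12 * b"
      unfolding \<epsilon>12 K_def by (simp add: field_simps power2_eq_square)
    finally show ?thesis unfolding XX_def G_def a_def b_def .
  qed
  ultimately show ?thesis by (rule that)
qed

end

theorem theorem3:
  fixes A :: "real^'n::finite^'n"
    and fi :: "'n \<Rightarrow> real^'p::finite \<Rightarrow> real"
    and gi :: "'n \<Rightarrow> real^'p \<Rightarrow> real^'p"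
    and Lf \<kappa>2 \<alpha> \<beta> \<eta> :: real
    and \<delta> :: "'n \<Rightarrow> nat \<Rightarrow> real"
    and x v :: "nat \<Rightarrow> 'n \<Rightarrow> real^'p"
    and T :: nat
  defines "L \<equiv> laplacian A"
    and "n \<equiv> real CARD('n)"
    and "p \<equiv> real CARD('p)"
    and "f \<equiv> favg fi"
    and "g \<equiv> gavg gi"
    and "fstar \<equiv> Inf (range (favg fi))"
    and "xbar \<equiv> (\<lambda>k. avg (x k))"
  assumes n2: "CARD('n) \<ge> 2"
    and graph: "weighted_undirected_graph A"
    and A1: "graph_connected A"
    and A2: "\<exists>xs. \<forall>y. f xs \<le> f y"
    and A3_grad: "\<And>i y. GDERIV (fi i) y :> gi i y"
    and A3_lip: "\<And>i y z. norm (gi i y - gi i z) \<le> Lf * norm (y - z)"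
    and Lf_pos: "Lf > 0"
    and \<kappa>2: "\<kappa>2 > 1"
    and \<beta>1: "\<beta> > ((2 + 9 * Lf\<^sup>2) / (2 * rho2 L)) / (\<kappa>2 - 1)"
    and \<beta>2: "\<beta> > (1 + sqrt (1 + 8 * \<kappa>2 + 8 / rho2 L)) / 4"
    and \<beta>3: "\<beta> > 6 * (\<kappa>2 + 1 / rho2 L) * Lf\<^sup>2
                 + 2 * sqrt (9 * (\<kappa>2 + 1 / rho2 L)\<^sup>2 * Lf ^ 4 + 3 * Lf\<^sup>2)"
    and \<alpha>1: "\<alpha> > \<beta> + (2 + 9 * Lf\<^sup>2) / (2 * rho2 L)"
    and \<alpha>2: "\<alpha> \<le> \<kappa>2 * \<beta>"
    and \<eta>0: "\<eta> > 0"
    and \<eta>1: "\<eta> < ((\<alpha> - \<beta>) * rho2 L - (2 + 9 * Lf\<^sup>2) / 2)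
                 / (\<beta>\<^sup>2 * rho L + (2 * \<alpha>\<^sup>2 + \<beta>\<^sup>2) * (rho L)\<^sup>2 + 15 / 2 * Lf\<^sup>2)"
    and \<eta>2: "\<eta> < (\<beta> - 1/2 - \<alpha> / (2 * \<beta>\<^sup>2) - 1 / (2 * \<beta> * rho2 L)) / (2 * \<beta>\<^sup>2 + 1/2)"
    and \<eta>3: "\<eta> < (1/8 - 3 / (2 * \<beta>) * (1 / \<beta> + 1 / rho2 L + \<alpha> / \<beta>) * Lf\<^sup>2)
                 / (3 / \<beta>\<^sup>2 * (1 + 1 / rho2 L + \<alpha> / \<beta>) * Lf\<^sup>2 + Lf * (1 + 3 * Lf) / 2)"
    and \<delta>_pos: "\<And>i k. \<delta> i k > 0"
    and \<delta>_sum: "\<And>i. summable (\<lambda>k. (\<delta> i k)\<^sup>2)"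
    and v0: "(\<Sum>j\<in>UNIV. v 0 j) = 0"
    and x_step: "\<And>i k. x (Suc k) i = x k i - \<eta> *\<^sub>R
                   (\<alpha> *\<^sub>R (\<Sum>j\<in>UNIV. L$i$j *\<^sub>R x k j) + \<beta> *\<^sub>R v k i
                    + grad_est (fi i) (x k i) (\<delta> i k))"
    and v_step: "\<And>i k. v (Suc k) i = v k i + (\<eta> * \<beta>) *\<^sub>R (\<Sum>j\<in>UNIV. L$i$j *\<^sub>R x k j)"
  shows "(\<Sum>k\<le>T. (\<Sum>i\<in>UNIV. (norm (x k i - xbar k))\<^sup>2) + n * (norm (g (xbar k)))\<^sup>2)
           \<le> (let \<epsilon>7 = \<eta> * min (((\<alpha> - \<beta>) * rho2 L - (2 + 9 * Lf\<^sup>2) / 2)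
                        - \<eta> * (\<beta>\<^sup>2 * rho L + (2 * \<alpha>\<^sup>2 + \<beta>\<^sup>2) * (rho L)\<^sup>2 + 15 / 2 * Lf\<^sup>2)) (1/8);
                  \<epsilon>8 = (\<alpha> + \<beta>) / (2 * \<beta>) + 1 / (2 * rho2 L);
                  \<epsilon>12 = ((1 / \<beta>\<^sup>2 + 1 / (2 * \<eta> * \<beta>)) * (1 / rho2 L + \<alpha> / \<beta>)
                         + 1 / (2 * \<eta> * \<beta>\<^sup>2) + 1 / \<beta>\<^sup>2 + 1/2) * (3 * n * p * Lf\<^sup>2 / 4);
                  \<epsilon>11 = (15 * \<eta> / 4 + 5 * \<eta>\<^sup>2) * (3 * n * p * Lf\<^sup>2 / 4) + \<epsilon>12;
                  \<delta>0 = Max (range (\<lambda>i. \<delta> i 0));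
                  U0 = knorm2 (x 0) + knorm2 (\<lambda>i. v 0 i + (1 / \<beta>) *\<^sub>R grad_est (fi i) (xbar 0) \<delta>0)
                       + n * (f (xbar 0) - fstar);
                  c = \<epsilon>8 * U0 + (\<epsilon>11 + \<epsilon>12) * (\<Sum>i\<in>UNIV. suminf (\<lambda>k. (\<delta> i k)\<^sup>2))
              in c / \<epsilon>7)
       \<and> f (xbar (Suc T)) - fstar
           \<le> (let \<epsilon>8 = (\<alpha> + \<beta>) / (2 * \<beta>) + 1 / (2 * rho2 L);
                  \<epsilon>12 = ((1 / \<beta>\<^sup>2 + 1 / (2 * \<eta> * \<beta>)) * (1 / rho2 L + \<alpha> / \<beta>)
                         + 1 / (2 * \<eta> * \<beta>\<^sup>2) + 1 / \<beta>\<^sup>2 + 1/2) * (3 * n * p * Lf\<^sup>2 / 4);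
                  \<epsilon>11 = (15 * \<eta> / 4 + 5 * \<eta>\<^sup>2) * (3 * n * p * Lf\<^sup>2 / 4) + \<epsilon>12;
                  \<delta>0 = Max (range (\<lambda>i. \<delta> i 0));
                  U0 = knorm2 (x 0) + knorm2 (\<lambda>i. v 0 i + (1 / \<beta>) *\<^sub>R grad_est (fi i) (xbar 0) \<delta>0)
                       + n * (f (xbar 0) - fstar);
                  c = \<epsilon>8 * U0 + (\<epsilon>11 + \<epsilon>12) * (\<Sum>i\<in>UNIV. suminf (\<lambda>k. (\<delta> i k)\<^sup>2))
              in c / n)"
proof -
  define r R where "r = rho2 L" and "R = rho L"
  define \<epsilon>1 where "\<epsilon>1 = (\<alpha> - \<beta>) * r - (2 + 9 * Lf\<^sup>2) / 2"
  define \<epsilon>2 where "\<epsilon>2 = \<beta>\<^sup>2 * R + (2 * \<alpha>\<^sup>2 + \<beta>\<^sup>2) * R\<^sup>2 + 15 / 2 * Lf\<^sup>2"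
  define \<epsilon>6 where "\<epsilon>6 = 3 / \<beta>\<^sup>2 * (1 + 1 / r + \<alpha> / \<beta>) * Lf\<^sup>2 + Lf * (1 + 3 * Lf) / 2"
  define \<epsilon>7 where "\<epsilon>7 = \<eta> * min (\<epsilon>1 - \<eta> * \<epsilon>2) (1/8)"
  define \<epsilon>8 where "\<epsilon>8 = (\<alpha> + \<beta>) / (2 * \<beta>) + 1 / (2 * r)"
  define \<epsilon>12 where "\<epsilon>12 = ((1 / \<beta>\<^sup>2 + 1 / (2 * \<eta> * \<beta>)) * (1 / r + \<alpha> / \<beta>)
      + 1 / (2 * \<eta> * \<beta>\<^sup>2) + 1 / \<beta>\<^sup>2 + 1/2) * (3 * n * p * Lf\<^sup>2 / 4)"
  define \<epsilon>11 where "\<epsilon>11 = (15 * \<eta> / 4 + 5 * \<eta>\<^sup>2) * (3 * n * p * Lf\<^sup>2 / 4) + \<epsilon>12"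
  define U0 where "U0 = knorm2 (x 0)
      + knorm2 (\<lambda>i. v 0 i + (1 / \<beta>) *\<^sub>R grad_est (fi i) (xbar 0) (Max (range (\<lambda>i. \<delta> i 0)))) + n * (f (xbar 0) - fstar)"
  define B where "B = (\<Sum>i\<in>UNIV. suminf (\<lambda>k. (\<delta> i k)\<^sup>2))"
  define c where "c = \<epsilon>8 * U0 + (\<epsilon>11 + \<epsilon>12) * B"
  interpret G: connected_graph A
    using graph A1 n2 by unfold_locales
  have r: "r > 0" and R: "R > 0"
    unfolding r_def R_def L_def by (rule G.rho2_pos, rule G.rho_pos)
  have n: "n > 0" and p: "p > 0" by (simp_all add: n_def p_def)
  have "0 < (1 + sqrt (1 + 8 * \<kappa>2 + 8 / r)) / 4" using \<kappa>2 r by (simp add: add_pos_nonneg)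
  then have \<beta>: "\<beta> > 0" using \<beta>2 unfolding r_def by (rule less_trans)
  have "0 < (2 + 9 * Lf\<^sup>2) / (2 * r)" using r by (simp add: add_pos_nonneg)
  then have \<alpha>: "\<beta> < \<alpha>" using \<alpha>1 unfolding r_def by linarith
  interpret pd: zeroth_order_primal_dual A fi gi n p Lf \<alpha> \<beta> \<eta> \<delta> x v
    using A3_grad A3_lip Lf_pos \<beta> \<alpha> \<eta>0 \<delta>_pos v0 x_step v_step
    by unfold_locales (simp_all add: n_def p_def L_def)
  obtain xs where xs: "f xs \<le> f y" for y using A2 by blast
  have lower: "fstar \<le> favg fi y" for y
  proof -
    \<comment> \<open>The infimum is a genuine lower bound because the minimum is attained.\<close>
    have "bdd_below (range (favg fi))" using xs unfolding f_def by (auto intro: bdd_belowI[of _ "favg fi xs"])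
    then show ?thesis unfolding fstar_def by (rule cInf_lower[rotated]) simp
  qed
  have xbar: "pd.xbar = xbar" by (simp add: fun_eq_iff pd.xbar_def xbar_def)
  have h0: "pd.h0 0 i = grad_est (fi i) (xbar 0) (Max (range (\<lambda>i. \<delta> i 0)))" for i
    by (simp add: pd.h0_def pd.\<delta>max_def xbar)
  have \<epsilon>2: "\<epsilon>2 > 0" using R Lf_pos unfolding \<epsilon>2_def by (intro add_nonneg_pos) auto
  have "\<eta> < \<epsilon>1 / \<epsilon>2" using \<eta>1 unfolding \<epsilon>1_def \<epsilon>2_def r_def R_def .
  then have dissipation: "\<epsilon>1 - \<eta> * \<epsilon>2 > 0" using \<epsilon>2 by (simp add: pos_less_divide_eq)
  then have \<epsilon>7: "\<epsilon>7 > 0" using \<eta>0 unfolding \<epsilon>7_def by simp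
  have \<eta>w: "\<eta> * (2 * \<beta>\<^sup>2 + 1/2) \<le> \<beta> - 1/2 - \<alpha> / (2 * \<beta>\<^sup>2) - 1 / (2 * \<beta> * r)"
    using \<eta>2 by (subst (asm) pos_less_divide_eq) (auto simp: r_def intro: add_nonneg_pos)
  have \<epsilon>6: "\<epsilon>6 > 0"
    unfolding \<epsilon>6_def using \<beta> \<alpha> r Lf_pos by (intro add_nonneg_pos mult_nonneg_nonneg) auto
  have "\<eta> < (1/8 - 3 / (2 * \<beta>) * (1 / \<beta> + 1 / r + \<alpha> / \<beta>) * Lf\<^sup>2) / \<epsilon>6"
    using \<eta>3 unfolding \<epsilon>6_def r_def .
  then have "\<eta> * \<epsilon>6 < 1/8 - 3 / (2 * \<beta>) * (1 / \<beta> + 1 / r + \<alpha> / \<beta>) * Lf\<^sup>2"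
    using \<epsilon>6 by (simp only: pos_less_divide_eq)
  then have \<eta>h: "\<eta> * \<epsilon>6 \<le> 1/2 - 3 / (2 * \<beta>) * (1 / \<beta> + 1 / r + \<alpha> / \<beta>) * Lf\<^sup>2"
    by linarith
  define S where "S k = (\<Sum>i\<in>UNIV. (norm (x k i - xbar k))\<^sup>2) + n * (norm (g (xbar k)))\<^sup>2" for k
  define b where "b k = (pd.\<delta>max k)\<^sup>2" for k
  obtain V where V_lower: "\<And>k. n * (f (xbar k) - fstar) \<le> V k" and V0: "V 0 \<le> \<epsilon>8 * U0"
    and V_step: "\<And>k. V (Suc k) \<le> V k - \<eta> * (\<epsilon>1 - \<eta> * \<epsilon>2) * (\<Sum>i\<in>UNIV. (norm (x k i - xbar k))\<^sup>2)
      - \<eta> / 2 * (n * (norm (g (xbar k)))\<^sup>2) + \<epsilon>11 * b k + \<epsilon>12 * b (Suc k)"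
    by (rule pd.lyapunov_function[of fstar, OF lower \<eta>w[unfolded r_def L_def] \<eta>h[unfolded \<epsilon>6_def r_def L_def]])
      (simp only: xbar h0 pd.X_norm f_def g_def L_def r_def R_def \<epsilon>1_def \<epsilon>2_def \<epsilon>8_def \<epsilon>11_def \<epsilon>12_def U0_def b_def, blast)
  have "V (Suc k) \<le> V k - \<epsilon>7 * S k + \<epsilon>11 * b k + \<epsilon>12 * b (Suc k)" for k
  proof -
    have "min (\<epsilon>1 - \<eta> * \<epsilon>2) (1/8) \<le> 1/2" by (rule min.coboundedI2) simp
    then have "\<epsilon>7 \<le> \<eta> * (\<epsilon>1 - \<eta> * \<epsilon>2)" "\<epsilon>7 \<le> \<eta> / 2"
      unfolding \<epsilon>7_def using \<eta>0 mult_left_mono[of _ "1/2" \<eta>] by simp_all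
    then have "\<epsilon>7 * S k \<le> \<eta> * (\<epsilon>1 - \<eta> * \<epsilon>2) * (\<Sum>i\<in>UNIV. (norm (x k i - xbar k))\<^sup>2)
        + \<eta> / 2 * (n * (norm (g (xbar k)))\<^sup>2)"
      using n unfolding S_def distrib_left by (intro add_mono mult_right_mono) (auto intro: sum_nonneg)
    with V_step[of k] show ?thesis by linarith
  qed
  then have sum_le: "V (Suc T) + \<epsilon>7 * (\<Sum>k\<le>T. S k)
      \<le> V 0 + \<epsilon>11 * (\<Sum>k\<le>T. b k) + \<epsilon>12 * (\<Sum>k\<le>T. b (Suc k))"
    by (rule telescope_descent)
  \<comment> \<open>Stated for arbitrary finite index sets so that it also covers the sum shifted by
    one.\<close>
  have b_sum: "(\<Sum>k\<in>I. b k) \<le> B" if "finite I" for I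
  proof -
    have "(\<Sum>k\<in>I. b k) \<le> (\<Sum>k\<in>I. \<Sum>i\<in>UNIV. (\<delta> i k)\<^sup>2)"
      unfolding b_def by (intro sum_mono pd.\<delta>max_squared_le)
    also have "\<dots> = (\<Sum>i\<in>UNIV. \<Sum>k\<in>I. (\<delta> i k)\<^sup>2)" by (rule sum.swap)
    also have "\<dots> \<le> B"
      unfolding B_def by (intro sum_mono sum_le_suminf \<delta>_sum that) auto
    finally show ?thesis .
  qed
  have shifted: "(\<Sum>k\<le>T. b (Suc k)) \<le> B"
    using b_sum[of "Suc ` {..T}"] by (simp add: sum.reindex)
  have \<epsilon>12: "\<epsilon>12 \<ge> 0"
    unfolding \<epsilon>12_def using \<beta> \<alpha> r \<eta>0 n p by (intro mult_nonneg_nonneg add_nonneg_nonneg) auto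
  then have \<epsilon>11: "\<epsilon>11 \<ge> 0"
    unfolding \<epsilon>11_def using \<eta>0 n p by (intro mult_nonneg_nonneg add_nonneg_nonneg) auto
  \<comment> \<open>Each claim follows by discarding one nonnegative part: the terminal value
    \<open>V (Suc T)\<close> or the accumulated dissipation.\<close>
  have main: "V (Suc T) + \<epsilon>7 * (\<Sum>k\<le>T. S k) \<le> c"
    using sum_le V0 mult_left_mono[OF b_sum \<epsilon>11, of "{..T}"] mult_left_mono[OF shifted \<epsilon>12]
    by (simp add: c_def distrib_right)
  have V_nonneg: "0 \<le> n * (f (xbar (Suc T)) - fstar)"
    using lower[of "xbar (Suc T)"] n by (simp add: f_def)
  have "(\<Sum>k\<le>T. S k) * \<epsilon>7 \<le> c"
    using main V_nonneg V_lower[of "Suc T"] by (simp add: mult.commute)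
  then have bound1: "(\<Sum>k\<le>T. S k) \<le> c / \<epsilon>7"
    using \<epsilon>7 by (simp add: pos_le_divide_eq)
  have "0 \<le> \<epsilon>7 * (\<Sum>k\<le>T. S k)"
    using \<epsilon>7 n unfolding S_def by (intro mult_nonneg_nonneg sum_nonneg add_nonneg_nonneg) auto
  then have "(f (xbar (Suc T)) - fstar) * n \<le> c"
    using main V_lower[of "Suc T"] by (simp add: mult.commute)
  then have bound2: "f (xbar (Suc T)) - fstar \<le> c / n"
    using n by (simp add: pos_le_divide_eq)
  show ?thesis
    using bound1 bound2
    unfolding Let_def S_def c_def \<epsilon>7_def \<epsilon>8_def \<epsilon>11_def \<epsilon>12_def \<epsilon>1_def \<epsilon>2_def U0_def B_def r_def R_def
    by (rule conjI)
qed

end
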